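(* Let $M\in\mathbb R^{n\times n}$ be hyperbolic, with stable and unstable subspaces $E_s,E_u$, $\dim E_s+\dim E_u=n$, and let the columns of $V_s$ and $V_u$ be (fixed, horizon-independent) bases of $E_s$ and $E_u$. Write $MV_s=V_sD_s$ and $MV_u=V_uD_u$, and assume that for some $K\ge1$ and $\gamma>0$, $$\|V_sD_s^k\|\le Ke^{-\gamma k},\qquad \|V_uD_u^{-k}\|\le Ke^{-\gamma k}\qquad\text{for all integers }k\ge0 .$$ Let $\mathsf B_0,\mathsf B_T\in\mathbb R^{n\times n}$ be fixed matrices and consider, for a horizon $N\in\mathbb N$, the linear boundary-value problem $$h_{t+1}=Mh_t+g_t,\quad 0\le t<N,\qquad \mathsf B_0h_0+\mathsf B_Th_N=b .\tag{$*$}$$ For each $N$ define the scaled boundary matrix $$\widehat\Gamma_N=\bigl[\ \mathsf B_0V_s+\mathsf B_TV_sD_s^{\,N}\quad \mathsf B_0V_uD_u^{-N}+\mathsf B_TV_u\ \bigr]$$ (superscripts on $D_s,D_u$ are powers). Let $T_0\ge1$. (i) If $\widehat\Gamma_N$ is invertible for every $N\ge T_0$ and $\sup_{N\ge T_0}\|\widehat\Gamma_N^{-1}\|<\infty$, then the uniform Green property holds for $( * )$, i.e. for the triple $(L,\mathsf B_0,\mathsf B_T)$ with $L[h,h^+]=h^+-Mh$, with exponent $\gamma$, initial horizon $T_0$, and a constant $C_G$ depending only on the dichotomy bounds $(K,\gamma)$, the norms of the spectral projectors onto $E_s$ and $E_u$, the fixed boundary matrices $\mathsf B_0,\mathsf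 B_T$, and $\sup_{N\ge T_0}\|\widehat\Gamma_N^{-1}\|$. (ii) Moreover, $\widehat\Gamma_N$ is invertible for every $N\ge T_0$ with $\sup_{N\ge T_0}\|\widehat\Gamma_N^{-1}\|<\infty$ whenever $$\widehat\Gamma_\infty:=[\ \mathsf B_0V_s\quad \mathsf B_TV_u\ ]$$ is invertible and, for some cutoff $N_*$ with $\sup_{N\ge N_*}\|\widehat\Gamma_\infty^{-1}\|\,\|\widehat\Gamma_N-\widehat\Gamma_\infty\|<1$, each matrix $\widehat\Gamma_N$ with $T_0\le N<N_*$ is invertible.
   Context: Hyperbolic means that $M$ has no eigenvalue on the unit circle; $E_s$ (resp. $E_u$) is the real invariant subspace associated with eigenvalues of modulus $<1$ (resp. $>1$). Uniform Green property. Fix norms on the finite-dimensional spaces. Let $L:\mathbb R^n\times\mathbb R^n\to\mathbb R^n$ be linear and let $\mathsf B_0,\mathsf B_T\in\mathbb R^{n\times n}$ be fixed boundary-row matrices (not necessarily invertible individually; the subscript $T$ is only a label for the terminal row). Given $C_G\ge1$, $\gamma>0$ and an integer $T_0\ge1$, the triple $(L,\mathsf B_0,\mathsf B_T)$ has the uniform Green property with constants $(C_G,\gamma,T_0)$ if for every integer $T\ge T_0$, every $f=(f_0,\dots,f_{T-1})$ with $f_t\in\mathbb R^n$, and every $b\in\mathbb R^n$: (WP) the problem $L[h_t,h_{t+1}]=f_t$ $(0\le t<T)$, $\mathsf B_0h_0+\mathsf B_Th_T=b$ has a unique solution $h=(h_0,\dots,h_T)$; and (G) with $\kappa_T(t,s)=e^{-\gamma|t-s|}+e^{-\gamma(t+T-s)}+e^{-\gamma(T-t+s)}$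 for $0\le s<T$, this solution satisfies, for all $0\le t\le T$, $$\|h_t\|\le C_G\Bigl[(e^{-\gamma t}+e^{-\gamma(T-t)})\|b\|+\sum_{s=0}^{T-1}\kappa_T(t,s)\|f_s\|\Bigr].$$ The constants do not depend on $T$. *)

theory Defs
  imports
    "HOL-Library.Extended_Real"
    "HOL-Library.FuncSet"
    "Jordan_Normal_Form.Char_Poly"
    "Jordan_Normal_Form.Matrix_Kernel"
    "Jordan_Normal_Form.Gauss_Jordan_Elimination"
    "Jordan_Normal_Form.VS_Connect"
begin

text \<open>
  Dimensions are natural numbers (carrier sets \<open>carrier_vec\<close>, \<open>carrier_mat\<close>), because one of the two
  spectral subspaces may be trivial, so that a basis matrix may have no columns.
\<close>

definition is_vec_norm :: "nat \<Rightarrow> (real vec \<Rightarrow> real) \<Rightarrow> bool" where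
  "is_vec_norm k \<nu> \<longleftrightarrow>
     (\<forall>x \<in> carrier_vec k. 0 \<le> \<nu> x \<and> (\<nu> x = 0 \<longleftrightarrow> x = 0\<^sub>v k)) \<and>
     (\<forall>x \<in> carrier_vec k. \<forall>c. \<nu> (c \<cdot>\<^sub>v x) = \<bar>c\<bar> * \<nu> x) \<and>
     (\<forall>x \<in> carrier_vec k. \<forall>y \<in> carrier_vec k. \<nu> (x + y) \<le> \<nu> x + \<nu> y)"

text \<open>
  A family \<open>\<nu>\<close> fixes one norm \<open>\<nu> k\<close> on each space of real \<open>k\<close>-vectors; matrices carry the induced
  operator norm. The unit ball contains \<open>0\<close>, so the supremum is also right for matrices without columns.
\<close>

definition op_norm :: "(nat \<Rightarrow> real vec \<Rightarrow> real) \<Rightarrow> real mat \<Rightarrow> real" where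
  "op_norm \<nu> A =
     (SUP x \<in> {x \<in> carrier_vec (dim_col A). \<nu> (dim_col A) x \<le> 1}. \<nu> (dim_row A) (A *\<^sub>v x))"

text \<open>Meaningful for invertible matrices only.\<close>

definition mat_inv :: "real mat \<Rightarrow> real mat" where
  "mat_inv A = the (mat_inverse A)"

definition append_columns :: "real mat \<Rightarrow> real mat \<Rightarrow> real mat" where
  "append_columns A B = four_block_mat A B (0\<^sub>m 0 (dim_col A)) (0\<^sub>m 0 (dim_col B))"

definition hyperbolic :: "real mat \<Rightarrow> bool" where
  "hyperbolic M \<longleftrightarrow> (\<forall>z. eigenvalue (map_mat complex_of_real M) z \<longrightarrow> cmod z \<noteq> 1)"

text \<open>
  The real vectors whose complexification lies in the sum of the generalized eigenspaces
  \<open>ker (M - z I)\<^sup>n\<close> over the complex eigenvalues \<open>z\<close> in \<open>\<Lambda>\<close>.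
\<close>

definition spectral_subspace :: "nat \<Rightarrow> real mat \<Rightarrow> complex set \<Rightarrow> real vec set" where
  "spectral_subspace n M \<Lambda> =
     {v \<in> carrier_vec n. map_vec complex_of_real v \<in>
        LinearCombinations.module.span class_ring (module_vec TYPE(complex) n)
          (\<Union>z \<in> {z \<in> \<Lambda>. eigenvalue (map_mat complex_of_real M) z}.
             mat_kernel (char_matrix (map_mat complex_of_real M) z ^\<^sub>m n))}"

definition stable_subspace :: "nat \<Rightarrow> real mat \<Rightarrow> real vec set" where
  "stable_subspace n M = spectral_subspace n M {z. cmod z < 1}"

definition unstable_subspace :: "nat \<Rightarrow> real mat \<Rightarrow> real vec set" where
  "unstable_subspace n M = spectral_subspace n M {z. cmod z > 1}"

abbreviation subspace_of :: "nat \<Rightarrow> real vec set \<Rightarrow> (real, real vec) module" where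
  "subspace_of n E \<equiv> (module_vec TYPE(real) n)\<lparr>carrier := E\<rparr>"

definition columns_basis :: "nat \<Rightarrow> real vec set \<Rightarrow> real mat \<Rightarrow> bool" where
  "columns_basis n E V \<longleftrightarrow>
     dim_row V = n \<and> distinct (cols V) \<and>
     vectorspace.basis class_ring (subspace_of n E) (set (cols V))"

text \<open>The projector onto \<open>E\<close> along \<open>F\<close>, for complementary subspaces \<open>E\<close> and \<open>F\<close>.\<close>

definition projector :: "nat \<Rightarrow> real vec set \<Rightarrow> real vec set \<Rightarrow> real mat" where
  "projector n E F =
     (THE P. P \<in> carrier_mat n n \<and> (\<forall>v \<in> E. P *\<^sub>v v = v) \<and> (\<forall>v \<in> F. P *\<^sub>v v = 0\<^sub>v n))"

definition stable_projector :: "nat \<Rightarrow> real mat \<Rightarrow> real mat" where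
  "stable_projector n M = projector n (stable_subspace n M) (unstable_subspace n M)"

definition unstable_projector :: "nat \<Rightarrow> real mat \<Rightarrow> real mat" where
  "unstable_projector n M = projector n (unstable_subspace n M) (stable_subspace n M)"

definition dichotomy ::
  "(nat \<Rightarrow> real vec \<Rightarrow> real) \<Rightarrow> nat \<Rightarrow> real mat \<Rightarrow> real mat \<Rightarrow> real mat \<Rightarrow> real mat \<Rightarrow> real mat
     \<Rightarrow> real \<Rightarrow> real \<Rightarrow> bool" where
  "dichotomy \<nu> n M Vs Vu Ds Du K \<gamma> \<longleftrightarrow>
     M \<in> carrier_mat n n \<and> hyperbolic M \<and>
     vectorspace.dim class_ring (subspace_of n (stable_subspace n M)) +
       vectorspace.dim class_ring (subspace_of n (unstable_subspace n M)) = n \<and>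
     columns_basis n (stable_subspace n M) Vs \<and>
     columns_basis n (unstable_subspace n M) Vu \<and>
     Ds \<in> carrier_mat (dim_col Vs) (dim_col Vs) \<and> M * Vs = Vs * Ds \<and>
     Du \<in> carrier_mat (dim_col Vu) (dim_col Vu) \<and> M * Vu = Vu * Du \<and>
     K \<ge> 1 \<and> \<gamma> > 0 \<and>
     (\<forall>k. op_norm \<nu> (Vs * (Ds ^\<^sub>m k)) \<le> K * exp (- \<gamma> * real k)) \<and>
     (\<forall>k. op_norm \<nu> (Vu * (mat_inv Du ^\<^sub>m k)) \<le> K * exp (- \<gamma> * real k))"

definition Gamma_hat ::
  "real mat \<Rightarrow> real mat \<Rightarrow> real mat \<Rightarrow> real mat \<Rightarrow> real mat \<Rightarrow> real mat \<Rightarrow> nat \<Rightarrow> real mat" where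
  "Gamma_hat B\<^sub>0 B\<^sub>T Vs Vu Ds Du N =
     append_columns (B\<^sub>0 * Vs + B\<^sub>T * Vs * (Ds ^\<^sub>m N)) (B\<^sub>0 * Vu * (mat_inv Du ^\<^sub>m N) + B\<^sub>T * Vu)"

definition Gamma_inf :: "real mat \<Rightarrow> real mat \<Rightarrow> real mat \<Rightarrow> real mat \<Rightarrow> real mat" where
  "Gamma_inf B\<^sub>0 B\<^sub>T Vs Vu = append_columns (B\<^sub>0 * Vs) (B\<^sub>T * Vu)"

text \<open>\<open>sup\<^bsub>N \<ge> T0\<^esub> \<parallel>\<Gamma> N\<^sup>-\<^sup>1\<parallel>\<close> as an extended real, to be compared with \<open>\<infinity>\<close>.\<close>

definition sup_inv_norm :: "(nat \<Rightarrow> real vec \<Rightarrow> real) \<Rightarrow> (nat \<Rightarrow> real mat) \<Rightarrow> nat \<Rightarrow> ereal" where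
  "sup_inv_norm \<nu> \<Gamma> T0 = (SUP N \<in> {T0..}. ereal (op_norm \<nu> (mat_inv (\<Gamma> N))))"

definition linear_pair_map :: "nat \<Rightarrow> (real vec \<Rightarrow> real vec \<Rightarrow> real vec) \<Rightarrow> bool" where
  "linear_pair_map n L \<longleftrightarrow>
     (\<forall>x \<in> carrier_vec n. \<forall>y \<in> carrier_vec n. L x y \<in> carrier_vec n) \<and>
     (\<forall>x \<in> carrier_vec n. \<forall>y \<in> carrier_vec n. \<forall>x' \<in> carrier_vec n. \<forall>y' \<in> carrier_vec n.
        L (x + x') (y + y') = L x y + L x' y') \<and>
     (\<forall>c. \<forall>x \<in> carrier_vec n. \<forall>y \<in> carrier_vec n. L (c \<cdot>\<^sub>v x) (c \<cdot>\<^sub>v y) = c \<cdot>\<^sub>v L x y)"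

text \<open>
  Finite sequences \<open>(h\<^sub>0, \<dots>, h\<^sub>T)\<close> are extensional functions on \<open>{..T}\<close>, so that uniqueness is
  plain equality.
\<close>

definition bvp_solution ::
  "nat \<Rightarrow> (real vec \<Rightarrow> real vec \<Rightarrow> real vec) \<Rightarrow> real mat \<Rightarrow> real mat \<Rightarrow> nat
     \<Rightarrow> (nat \<Rightarrow> real vec) \<Rightarrow> real vec \<Rightarrow> (nat \<Rightarrow> real vec) \<Rightarrow> bool" where
  "bvp_solution n L B\<^sub>0 B\<^sub>T T f b h \<longleftrightarrow>
     h \<in> {..T} \<rightarrow>\<^sub>E carrier_vec n \<and>
     (\<forall>t<T. L (h t) (h (Suc t)) = f t) \<and>
     B\<^sub>0 *\<^sub>v h 0 + B\<^sub>T *\<^sub>v h T = b"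

definition green_kernel :: "real \<Rightarrow> nat \<Rightarrow> nat \<Rightarrow> nat \<Rightarrow> real" where
  "green_kernel \<gamma> T t s =
     exp (- \<gamma> * \<bar>real t - real s\<bar>) +
     exp (- \<gamma> * (real t + real T - real s)) +
     exp (- \<gamma> * (real T - real t + real s))"

definition uniform_green ::
  "(nat \<Rightarrow> real vec \<Rightarrow> real) \<Rightarrow> nat \<Rightarrow> (real vec \<Rightarrow> real vec \<Rightarrow> real vec) \<Rightarrow> real mat \<Rightarrow> real mat
     \<Rightarrow> real \<Rightarrow> real \<Rightarrow> nat \<Rightarrow> bool" where
  "uniform_green \<nu> n L B\<^sub>0 B\<^sub>T C \<gamma> T0 \<longleftrightarrow>
     linear_pair_map n L \<and> B\<^sub>0 \<in> carrier_mat n n \<and> B\<^sub>T \<in> carrier_mat n n \<and>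
     C \<ge> 1 \<and> \<gamma> > 0 \<and> T0 \<ge> 1 \<and>
     (\<forall>T\<ge>T0. \<forall>f \<in> {..<T} \<rightarrow>\<^sub>E carrier_vec n. \<forall>b \<in> carrier_vec n.
        (\<exists>!h. bvp_solution n L B\<^sub>0 B\<^sub>T T f b h) \<and>
        (\<forall>h. bvp_solution n L B\<^sub>0 B\<^sub>T T f b h \<longrightarrow>
           (\<forall>t\<le>T. \<nu> n (h t) \<le>
              C * ((exp (- \<gamma> * real t) + exp (- \<gamma> * (real T - real t))) * \<nu> n b +
                   (\<Sum>s<T. green_kernel \<gamma> T t s * \<nu> n (f s))))))"

end

theory Submission
  imports Defs "HOL-Analysis.Function_Topology" "Jordan_Normal_Form.DL_Rank"
begin

text \<open>
  In the coordinates \<open>h\<^sub>t = V\<^sub>s a\<^sub>t + V\<^sub>u c\<^sub>t\<close> the recursion decouples; solving the stable part forward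
  from \<open>a\<^sub>0\<close> and the unstable part backward from \<open>c\<^sub>N\<close> gives decaying orbits, and the boundary
  condition becomes \<open>\<Gamma>\<^sub>N (a\<^sub>0, c\<^sub>N) = b - \<rho>\<close>, where \<open>\<rho>\<close> collects the boundary values of the solution
  with \<open>a\<^sub>0 = 0\<close> and \<open>c\<^sub>N = 0\<close>. The bound on \<open>\<Gamma>\<^sub>N\<^sup>-\<^sup>1\<close> then yields the Green estimate. Letting
  \<open>N \<rightarrow> \<infinity>\<close> in \<open>\<parallel>a\<parallel> \<le> \<kappa> \<parallel>\<Gamma>\<^sub>N\<^sup>-\<^sup>1\<parallel> \<parallel>\<Gamma>\<^sub>N (a, 0)\<parallel>\<close> gives \<open>\<parallel>a\<parallel> \<le> \<kappa> S \<parallel>B\<^sub>0\<parallel> \<parallel>V\<^sub>s a\<parallel>\<close>, and symmetrically for \<open>V\<^sub>u\<close>;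
  this makes the constant independent of the chosen bases and, with the decay bounds, shows that
  the two subspaces are complementary. Part (ii) is a Neumann series argument.
\<close>

section \<open>Norms on coordinate spaces\<close>

text \<open>The constant has to be chosen before the dimension, the bases and the horizon, as a
  function of \<open>K\<close>, \<open>\<gamma>\<close>, the projector norms, the boundary matrices
  and the bound on the inverses. Two dependences stand in the way. Coordinates are measured by norms
  on \<open>r\<close>- and \<open>s\<close>-vectors, tied to the norm on \<open>n\<close>-vectors
  only by equivalence of norms; this costs a factor depending on \<open>n\<close> alone. The bases
  may also be rescaled, which the limit in \<open>N\<close> takes care of. The generalized
  eigenvectors supply two facts: the spectral subspaces are real subspaces, and the kernel of
  \<open>M\<close> meets the unstable one only in 0. The second makes \<open>Du\<close> invertible,
  so that \<open>mat_inv Du\<close> has a meaning. The last two terms of the Green kernel come from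
  the boundary condition: the effect of forcing at time \<open>s\<close> decays on its way to one
  end, is transferred by the inverse boundary matrix to the other end, and decays again on its way
  to time \<open>t\<close>. The factor \<open>exp \<gamma>\<close> in the constant arises because
  forcing with index \<open>s\<close> first acts at time \<open>s + 1\<close>.\<close>

lemma seminorm_le_coords:
  fixes p :: "real vec \<Rightarrow> real"
  assumes add: "\<And>x y. x \<in> carrier_vec k \<Longrightarrow> y \<in> carrier_vec k \<Longrightarrow> p (x + y) \<le> p x + p y"
    and smult: "\<And>c x. x \<in> carrier_vec k \<Longrightarrow> p (c \<cdot>\<^sub>v x) = \<bar>c\<bar> * p x"
    and x: "x \<in> carrier_vec k"
  shows "p x \<le> (\<Sum>i<k. \<bar>x $ i\<bar> * p (unit_vec k i))"
proof -
  \<comment> \<open>Truncations of \<open>x\<close>: each step adds one multiple of a unit vector,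
    and \<open>y 0\<close> has value 0 by homogeneity with the scalar 0.\<close>
  define y where "y m = vec k (\<lambda>i. if i < m then x $ i else 0)" for m
  have y: "y m \<in> carrier_vec k" for m
    by (simp add: y_def)
  have "m \<le> k \<Longrightarrow> p (y m) \<le> (\<Sum>i<m. \<bar>x $ i\<bar> * p (unit_vec k i))" for m
  proof (induction m)
    case 0
    have "y 0 = 0 \<cdot>\<^sub>v y 0"
      by (intro eq_vecI) (auto simp: y_def)
    with smult[OF y, of 0 0] show ?case by simp
  next
    case (Suc m)
    have "y (Suc m) = y m + x $ m \<cdot>\<^sub>v unit_vec k m"
      using Suc.prems by (intro eq_vecI) (auto simp: y_def less_Suc_eq)
    with add[OF y, of "x $ m \<cdot>\<^sub>v unit_vec k m" m] Suc show ?case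
      by (simp add: smult)
  qed
  moreover have "y k = x"
    using x by (intro eq_vecI) (auto simp: y_def)
  ultimately show ?thesis
    by (metis order_refl)
qed

context
  fixes \<nu> :: "nat \<Rightarrow> real vec \<Rightarrow> real"
  assumes norms: "\<And>k. is_vec_norm k (\<nu> k)"
begin

lemma vnorm_nonneg: "x \<in> carrier_vec k \<Longrightarrow> 0 \<le> \<nu> k x"
  using norms[of k] unfolding is_vec_norm_def by blast

lemma vnorm_eq_0_iff: "x \<in> carrier_vec k \<Longrightarrow> \<nu> k x = 0 \<longleftrightarrow> x = 0\<^sub>v k"
  using norms[of k] unfolding is_vec_norm_def by blast

lemma vnorm_zero: "\<nu> k (0\<^sub>v k) = 0"
  by (simp add: vnorm_eq_0_iff)

lemma vnorm_smult: "x \<in> carrier_vec k \<Longrightarrow> \<nu> k (c \<cdot>\<^sub>v x) = \<bar>c\<bar> * \<nu> k x"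
  using norms[of k] unfolding is_vec_norm_def by blast

lemma vnorm_add: "x \<in> carrier_vec k \<Longrightarrow> y \<in> carrier_vec k \<Longrightarrow> \<nu> k (x + y) \<le> \<nu> k x + \<nu> k y"
  using norms[of k] unfolding is_vec_norm_def by blast

lemma vnorm_uminus: "x \<in> carrier_vec k \<Longrightarrow> \<nu> k (- x) = \<nu> k x"
proof -
  have "- x = (-1) \<cdot>\<^sub>v x" by (intro eq_vecI) auto
  then show "x \<in> carrier_vec k \<Longrightarrow> \<nu> k (- x) = \<nu> k x" by (simp add: vnorm_smult)
qed

lemma vnorm_diff: "x \<in> carrier_vec k \<Longrightarrow> y \<in> carrier_vec k \<Longrightarrow> \<nu> k (x - y) \<le> \<nu> k x + \<nu> k y"
  using vnorm_add[of x k "- y"] by (simp add: vnorm_uminus minus_add_uminus_vec)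

text \<open>Vectors are parametrized by functions \<open>nat \<Rightarrow> real\<close> with the
  product topology, where Tychonoff supplies compact sets; the entries from \<open>k\<close> on are
  ignored. The estimate \<open>diff\<close> is the reverse triangle inequality in
  coordinates.\<close>

lemma continuous_on_vnorm: "continuous_on S (\<lambda>g. \<nu> k (vec k g))"
proof -
  have diff: "\<bar>\<nu> k (vec k g) - \<nu> k (vec k h)\<bar> \<le> (\<Sum>i<k. \<bar>g i - h i\<bar> * \<nu> k (unit_vec k i))" (is "_ \<le> ?R g h")
    for g h :: "nat \<Rightarrow> real"
  proof -
    have "\<nu> k (vec k g) \<le> \<nu> k (vec k h) + ?R g h" for g h :: "nat \<Rightarrow> real"
    proof -
      have "vec k g = vec k h + vec k (\<lambda>i. g i - h i)"
        by (intro eq_vecI) auto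
      then have "\<nu> k (vec k g) \<le> \<nu> k (vec k h) + \<nu> k (vec k (\<lambda>i. g i - h i))"
        using vnorm_add[of "vec k h" k "vec k (\<lambda>i. g i - h i)"] by simp
      also have "\<nu> k (vec k (\<lambda>i. g i - h i)) \<le> ?R g h"
        using seminorm_le_coords[of k "\<nu> k" "vec k (\<lambda>i. g i - h i)"] by (simp add: vnorm_add vnorm_smult)
      finally show ?thesis by simp
    qed
    from this[of g h] this[of h g] show ?thesis
      by (simp add: abs_minus_commute abs_le_iff)
  qed
  show ?thesis
    unfolding continuous_on_def
  proof
    fix h assume "h \<in> S"
    have "((\<lambda>g. g i) \<longlongrightarrow> h i) (at h within S)" for i
      using continuous_on_subset[OF continuous_on_product_coordinates subset_UNIV, of S i] \<open>h \<in> S\<close>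
      by (simp add: continuous_on_def)
    then have "((\<lambda>g. ?R g h) \<longlongrightarrow> ?R h h) (at h within S)"
      by (intro tendsto_sum tendsto_mult tendsto_rabs tendsto_diff tendsto_const)
    then have "((\<lambda>g. ?R g h) \<longlongrightarrow> 0) (at h within S)" by simp
    then have "((\<lambda>g. \<nu> k (vec k g) - \<nu> k (vec k h)) \<longlongrightarrow> 0) (at h within S)"
      by (rule tendsto_0_le[where K = 1])
         (simp add: order_trans[OF diff abs_ge_self])
    then show "((\<lambda>g. \<nu> k (vec k g)) \<longlongrightarrow> \<nu> k (vec k h)) (at h within S)"
      by (simp add: LIM_zero_iff)
  qed
qed

text \<open>Compactness, one coordinate at a time: on the face of the unit cube where coordinate
  \<open>i\<close> equals 1 the norm attains its minimum, which is positive because 0 is not on the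
  face. Dividing a nonzero vector by its entry of largest modulus moves it to such a face.\<close>

lemma coord_le_vnorm:
  shows "\<exists>c\<ge>0. \<forall>x \<in> carrier_vec k. \<forall>i<k. \<bar>x $ i\<bar> \<le> c * \<nu> k x"
proof -
  have "\<exists>m>0. \<forall>x \<in> carrier_vec k. x $ i = 1 \<longrightarrow> (\<forall>j<k. \<bar>x $ j\<bar> \<le> 1) \<longrightarrow> m \<le> \<nu> k x" if i: "i < k" for i
  proof -
    \<comment> \<open>All natural numbers serve as indices, so that \<open>F\<close> is a product
      over \<open>UNIV\<close>; the entries from \<open>k\<close> on merely range over
      [-1, 1].\<close>
    define F where "F = PiE UNIV (\<lambda>j. if j = i then {1} else {-1..1::real})"
    have "compact F"
      using compactin_PiE[of "\<lambda>_. euclidean" UNIV "\<lambda>j. if j = i then {1} else {-1..1::real}"]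
      unfolding F_def euclidean_product_topology compactin_euclidean_iff by simp
    have F: "h \<in> F \<longleftrightarrow> (\<forall>j. h j \<in> (if j = i then {1} else {-1..1}))" for h
      by (simp only: F_def PiE_iff extensional_UNIV) simp
    have "F \<noteq> {}"
      using F[of "\<lambda>_. 1"] by auto
    with \<open>compact F\<close> obtain g where g: "g \<in> F" "\<forall>h \<in> F. \<nu> k (vec k g) \<le> \<nu> k (vec k h)"
      using continuous_attains_inf[OF _ _ continuous_on_vnorm[of F k]] by metis
    have "vec k g \<noteq> 0\<^sub>v k"
    proof
      assume "vec k g = 0\<^sub>v k"
      then have "vec k g $ i = 0" using i by simp
      moreover have "g i \<in> {1}"
        using g(1) F by metis
      ultimately show False using i by simp
    qed
    then have "0 < \<nu> k (vec k g)"
      by (simp add: less_le vnorm_nonneg vnorm_eq_0_iff)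
    moreover have "\<nu> k (vec k g) \<le> \<nu> k x"
      if "x \<in> carrier_vec k" "x $ i = 1" "\<forall>j<k. \<bar>x $ j\<bar> \<le> 1" for x
    proof -
      have "(\<lambda>j. if j < k then x $ j else 0) \<in> F"
        using that i by (auto simp: F abs_le_iff minus_le_iff)
      moreover have "vec k (\<lambda>j. if j < k then x $ j else 0) = x"
        using that by (intro eq_vecI) auto
      ultimately show ?thesis using g(2) by (metis (no_types, lifting))
    qed
    ultimately show ?thesis by blast
  qed
  then have "\<forall>i. \<exists>m. i < k \<longrightarrow> m > 0 \<and> (\<forall>x \<in> carrier_vec k. x $ i = 1 \<longrightarrow> (\<forall>j<k. \<bar>x $ j\<bar> \<le> 1) \<longrightarrow> m \<le> \<nu> k x)"
    by blast
  then obtain m where m: "\<And>i. i < k \<Longrightarrow> 0 < m i"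
    "\<And>i x. i < k \<Longrightarrow> x \<in> carrier_vec k \<Longrightarrow> x $ i = 1 \<Longrightarrow> (\<forall>j<k. \<bar>x $ j\<bar> \<le> 1) \<Longrightarrow> m i \<le> \<nu> k x"
    using choice[where Q = "\<lambda>i m. i < k \<longrightarrow> m > 0 \<and> (\<forall>x \<in> carrier_vec k. x $ i = 1 \<longrightarrow> (\<forall>j<k. \<bar>x $ j\<bar> \<le> 1) \<longrightarrow> m \<le> \<nu> k x)"]
    by blast
  \<comment> \<open>The sum dominates every \<open>1 / m i\<close> and, unlike a maximum, also makes
    sense for \<open>k = 0\<close>.\<close>
  define c where "c = (\<Sum>i<k. 1 / m i)"
  have "0 \<le> c"
    unfolding c_def by (intro sum_nonneg) (simp add: m(1) less_imp_le)
  moreover have "\<bar>x $ i\<bar> \<le> c * \<nu> k x" if x: "x \<in> carrier_vec k" and i: "i < k" for x i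
  proof -
    have "Max ((\<lambda>i. \<bar>x $ i\<bar>) ` {..<k}) \<in> (\<lambda>i. \<bar>x $ i\<bar>) ` {..<k}"
      using i by (intro Max_in) auto
    then obtain j where j: "j < k" "Max ((\<lambda>i. \<bar>x $ i\<bar>) ` {..<k}) = \<bar>x $ j\<bar>" by auto
    have le: "\<bar>x $ l\<bar> \<le> \<bar>x $ j\<bar>" if "l < k" for l
      using that by (simp flip: j(2))
    show ?thesis
    proof (cases "x $ j = 0")
      case True
      then show ?thesis using le[OF i] \<open>0 \<le> c\<close> vnorm_nonneg[OF x] by simp
    next
      case False
      have "m j \<le> \<nu> k ((1 / x $ j) \<cdot>\<^sub>v x)"
        using x j False le by (intro m(2)) (auto simp: abs_mult)
      then have "m j * \<bar>x $ j\<bar> \<le> \<nu> k x"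
        using False by (simp add: vnorm_smult[OF x] field_simps)
      then have "\<bar>x $ j\<bar> \<le> 1 / m j * \<nu> k x"
        using m(1)[OF j(1)] by (simp add: field_simps)
      also have "\<dots> \<le> c * \<nu> k x"
        unfolding c_def using j m(1) vnorm_nonneg[OF x]
        by (intro mult_right_mono member_le_sum) (auto simp: less_imp_le)
      finally show ?thesis using le[OF i] by simp
    qed
  qed
  ultimately show ?thesis by blast
qed

text \<open>Equivalence of norms in one-sided form. Definiteness is not asked of \<open>p\<close>,
  so that it can be \<open>\<nu> r (A *\<^sub>v x)\<close>, for operator norms, or the sum of the
  norms of two blocks of a vector.\<close>

lemma seminorm_le_vnorm:
  fixes p :: "real vec \<Rightarrow> real"
  assumes add: "\<And>x y. x \<in> carrier_vec k \<Longrightarrow> y \<in> carrier_vec k \<Longrightarrow> p (x + y) \<le> p x + p y"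
    and smult: "\<And>c x. x \<in> carrier_vec k \<Longrightarrow> p (c \<cdot>\<^sub>v x) = \<bar>c\<bar> * p x"
  shows "\<exists>c\<ge>0. \<forall>x \<in> carrier_vec k. p x \<le> c * \<nu> k x"
proof -
  obtain c where c: "c \<ge> 0" "\<And>x i. x \<in> carrier_vec k \<Longrightarrow> i < k \<Longrightarrow> \<bar>x $ i\<bar> \<le> c * \<nu> k x"
    using coord_le_vnorm by blast
  define d where "d = (\<Sum>i<k. \<bar>p (unit_vec k i)\<bar>)"
  have "p x \<le> c * d * \<nu> k x" if x: "x \<in> carrier_vec k" for x
  proof -
    have "p x \<le> (\<Sum>i<k. \<bar>x $ i\<bar> * p (unit_vec k i))"
      using assms x by (rule seminorm_le_coords)
    also have "\<dots> \<le> (\<Sum>i<k. \<bar>x $ i\<bar> * \<bar>p (unit_vec k i)\<bar>)"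
      by (intro sum_mono mult_left_mono) auto
    also have "\<dots> \<le> (\<Sum>i<k. (c * \<nu> k x) * \<bar>p (unit_vec k i)\<bar>)"
      using c x by (intro sum_mono mult_right_mono) auto
    also have "\<dots> = c * d * \<nu> k x"
      by (simp add: d_def sum_distrib_left mult_ac)
    finally show ?thesis .
  qed
  moreover have "c * d \<ge> 0"
    using c by (simp add: d_def sum_nonneg)
  ultimately show ?thesis by blast
qed

section \<open>The induced operator norm\<close>

text \<open>A real supremum is informative only over a bounded set; this is what makes the
  \<open>cSUP\<close> rules applicable to \<open>op_norm\<close>.\<close>

lemma bdd_above_op_norm:
  assumes A: "A \<in> carrier_mat r c"
  shows "bdd_above ((\<lambda>x. \<nu> r (A *\<^sub>v x)) ` {x \<in> carrier_vec c. \<nu> c x \<le> 1})"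
proof -
  obtain d where d: "d \<ge> 0" "\<And>x. x \<in> carrier_vec c \<Longrightarrow> \<nu> r (A *\<^sub>v x) \<le> d * \<nu> c x"
    using seminorm_le_vnorm[of c "\<lambda>x. \<nu> r (A *\<^sub>v x)"] A
    by (auto simp: mult_add_distrib_mat_vec[OF A] mult_mat_vec[OF A] vnorm_add vnorm_smult)
  then have "\<nu> r (A *\<^sub>v x) \<le> d" if "x \<in> carrier_vec c" "\<nu> c x \<le> 1" for x
    using that by (meson mult_left_le order_trans)
  then show ?thesis by (intro bdd_aboveI[of _ d]) auto
qed

lemma op_norm_nonneg: "0 \<le> op_norm \<nu> A"
proof -
  have "A *\<^sub>v 0\<^sub>v (dim_col A) = 0\<^sub>v (dim_row A)" by (intro eq_vecI) auto
  then have "0 = \<nu> (dim_row A) (A *\<^sub>v 0\<^sub>v (dim_col A))" by (simp add: vnorm_zero)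
  also have "\<dots> \<le> op_norm \<nu> A"
    unfolding op_norm_def by (intro cSUP_upper bdd_above_op_norm) (auto simp: vnorm_zero)
  finally show ?thesis .
qed

lemma op_norm_le:
  assumes A: "A \<in> carrier_mat r c" and "d \<ge> 0"
    and le: "\<And>x. x \<in> carrier_vec c \<Longrightarrow> \<nu> r (A *\<^sub>v x) \<le> d * \<nu> c x"
  shows "op_norm \<nu> A \<le> d"
proof -
  have "\<nu> r (A *\<^sub>v x) \<le> d" if "x \<in> carrier_vec c" "\<nu> c x \<le> 1" for x
    using le[OF that(1)] that(2) \<open>d \<ge> 0\<close> by (meson mult_left_le order_trans)
  moreover have "{x \<in> carrier_vec c. \<nu> c x \<le> 1} \<noteq> {}"
    by (auto simp: vnorm_zero intro: exI[of _ "0\<^sub>v c"])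
  ultimately show ?thesis
    unfolding op_norm_def carrier_matD[OF A] by (intro cSUP_least) auto
qed

lemma vnorm_mult_mat_vec_le:
  assumes A: "A \<in> carrier_mat r c" and x: "x \<in> carrier_vec c"
  shows "\<nu> r (A *\<^sub>v x) \<le> op_norm \<nu> A * \<nu> c x"
proof (cases "\<nu> c x = 0")
  case True
  then have "x = 0\<^sub>v c" using x by (simp add: vnorm_eq_0_iff)
  moreover have "A *\<^sub>v 0\<^sub>v c = 0\<^sub>v r" using A by (intro eq_vecI) auto
  ultimately show ?thesis by (simp add: vnorm_zero)
next
  case False
  let ?y = "(1 / \<nu> c x) \<cdot>\<^sub>v x"
  have pos: "0 < \<nu> c x" using False vnorm_nonneg[OF x] by simp
  have "\<nu> r (A *\<^sub>v ?y) \<le> op_norm \<nu> A"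
    unfolding op_norm_def using A x pos bdd_above_op_norm[OF A]
    by (intro cSUP_upper2[where x = ?y]) (auto simp: vnorm_smult)
  then have "\<bar>1 / \<nu> c x\<bar> * \<nu> r (A *\<^sub>v x) \<le> op_norm \<nu> A"
    using A x by (simp add: mult_mat_vec[OF A x] vnorm_smult)
  then show ?thesis using pos by (simp add: field_simps)
qed

end

section \<open>Matrices and spectral subspaces\<close>

text \<open>The first conclusion will yield \<open>r + s = n\<close> from the invertibility of a
  boundary matrix. For the others it must be shown that \<open>mat_inverse\<close> succeeds, so that
  \<open>the\<close> in \<open>mat_inv\<close> does not act on \<open>None\<close>.\<close>

lemma invertible_matE:
  fixes A :: "real mat"
  assumes "invertible_mat A" "A \<in> carrier_mat n m"
  shows "m = n" "mat_inv A \<in> carrier_mat n n" "A * mat_inv A = 1\<^sub>m n" "mat_inv A * A = 1\<^sub>m n"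
proof -
  show m: "m = n"
    using assms by (auto simp: invertible_mat_def)
  then have A: "A \<in> carrier_mat n n" using assms by simp
  obtain B where B: "A * B = 1\<^sub>m n" "B * A = 1\<^sub>m (dim_row B)"
    using assms by (auto simp: invertible_mat_def inverts_mat_def)
  have "dim_col B = n"
    using arg_cong[OF B(1), of dim_col] by simp
  moreover have "dim_row B = n"
    using arg_cong[OF B(2), of dim_col] A by simp
  ultimately have "B \<in> carrier_mat n n" by auto
  with A B have "A \<in> Units (ring_mat TYPE(real) n ())"
    unfolding Units_def by (auto simp: ring_mat_def)
  then obtain C where C: "mat_inverse A = Some C"
    using mat_inverse(1)[OF A, of "()"] by (cases "mat_inverse A") auto
  then show "mat_inv A \<in> carrier_mat n n" "A * mat_inv A = 1\<^sub>m n" "mat_inv A * A = 1\<^sub>m n"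
    using mat_inverse(2)[OF A C] by (auto simp: mat_inv_def)
qed

lemma invertible_matI_inj:
  fixes A :: "real mat"
  assumes A: "A \<in> carrier_mat n n"
    and inj: "\<And>x. x \<in> carrier_vec n \<Longrightarrow> A *\<^sub>v x = 0\<^sub>v n \<Longrightarrow> x = 0\<^sub>v n"
  shows "invertible_mat A"
proof -
  have "det A \<noteq> 0"
    using det_0_iff_vec_prod_zero_field[OF A] inj by blast
  then obtain B where "B \<in> carrier_mat n n" "A * B = 1\<^sub>m n" "B * A = 1\<^sub>m n"
    using det_non_zero_imp_unit[OF A, of "()"] unfolding Units_def by (auto simp: ring_mat_def)
  then show ?thesis
    using A by (auto simp: invertible_mat_def inverts_mat_def)
qed

lemma mult_mat_zero_vec [simp]:
  fixes A :: "'a :: comm_ring_1 mat"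
  assumes "A \<in> carrier_mat n m" shows "A *\<^sub>v 0\<^sub>v m = 0\<^sub>v n"
  using assms by (intro eq_vecI) auto

text \<open>The basis is one of \<open>E\<close> as a vector space in its own right. Spans formed in
  \<open>E\<close> and in the ambient space agree, and the ambient span of the columns is the column
  space of \<open>V\<close>.\<close>

lemma columns_basis_span:
  assumes E: "subspace class_ring E (module_vec TYPE(real) n)"
    and V: "columns_basis n E V"
  shows "E = {V *\<^sub>v a | a. a \<in> carrier_vec (dim_col V)}"
proof -
  interpret vs: vec_space "TYPE(real)" n .
  have VS: "vectorspace class_ring (subspace_of n E)"
    using vs.subspace_is_vs[OF E] .
  have VV: "V \<in> carrier_mat n (dim_col V)"
    using V by (auto simp: columns_basis_def)
  have span: "LinearCombinations.module.span class_ring (subspace_of n E) (set (cols V)) = E"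
    and sub: "set (cols V) \<subseteq> E"
    using V VS unfolding columns_basis_def by (auto simp: vectorspace.basis_def[OF VS])
  have sm: "submodule class_ring E vs.V"
    using E by (simp add: subspace_def)
  have "vs.span (set (cols V)) = E"
    by (rule trans[OF vs.span_li_not_depend(1)[OF sub sm, symmetric] span])
  then have "E = {y \<in> carrier_vec n. \<exists>x \<in> carrier_vec (dim_col V). V *\<^sub>v x = y}"
    using vs.col_space_eq[OF VV] unfolding vs.col_space_def carrier_matD(1)[OF VV] by argo
  also have "\<dots> = {V *\<^sub>v a | a. a \<in> carrier_vec (dim_col V)}"
    using mult_mat_vec_carrier[OF VV] by blast
  finally show ?thesis .
qed

section \<open>Commuting factors and generalized eigenvectors\<close>

lemma pow_mat_commute:
  fixes X Y :: "'a :: comm_ring_1 mat"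
  assumes X: "X \<in> carrier_mat n n" and Y: "Y \<in> carrier_mat n n" and XY: "X * Y = Y * X"
  shows "X ^\<^sub>m k * Y = Y * X ^\<^sub>m k"
proof (induction k)
  case 0
  show ?case using X Y by simp
next
  case (Suc k)
  have k: "X ^\<^sub>m k \<in> carrier_mat n n" using X by simp
  have "X ^\<^sub>m Suc k * Y = X ^\<^sub>m k * (X * Y)"
    using assoc_mult_mat[OF k X Y] by simp
  also have "\<dots> = (X ^\<^sub>m k * Y) * X"
    using assoc_mult_mat[OF k Y X] by (simp add: XY)
  also have "\<dots> = Y * X ^\<^sub>m Suc k"
    using assoc_mult_mat[OF Y k X] by (simp add: Suc)
  finally show ?case .
qed

text \<open>Both products expand to the same expression, which is symmetric in \<open>z\<close> and
  \<open>w\<close>.\<close>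

lemma char_matrix_commute:
  assumes A: "A \<in> carrier_mat n n"
  shows "char_matrix A z * char_matrix A w = char_matrix A w * char_matrix A z"
proof -
  have *: "char_matrix A z * char_matrix A w = A * A + (- z) \<cdot>\<^sub>m A + (- w) \<cdot>\<^sub>m A + (z * w) \<cdot>\<^sub>m 1\<^sub>m n" for z w
  proof -
    have "char_matrix A z * char_matrix A w =
        A * A + (- z) \<cdot>\<^sub>m A + (- w) \<cdot>\<^sub>m (A + (- z) \<cdot>\<^sub>m 1\<^sub>m n)"
      using A unfolding char_matrix_def
      by (simp add: add_mult_distrib_mat[of _ n n] mult_add_distrib_mat[of _ n n]
          mult_smult_assoc_mat[of _ n n _ n] mult_smult_distrib[of _ n n _ n])
    also have "\<dots> = A * A + (- z) \<cdot>\<^sub>m A + (- w) \<cdot>\<^sub>m A + (z * w) \<cdot>\<^sub>m 1\<^sub>m n"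
      using A by (intro eq_matI) (auto simp: algebra_simps)
    finally show ?thesis .
  qed
  show ?thesis
    unfolding *[of z w] *[of w z] using A by (intro eq_matI) (auto simp: mult_ac)
qed

lemma char_matrix_pow_commute:
  assumes A: "A \<in> carrier_mat n n"
  shows "char_matrix A z ^\<^sub>m k * char_matrix A w ^\<^sub>m l = char_matrix A w ^\<^sub>m l * char_matrix A z ^\<^sub>m k"
  using pow_mat_commute[OF char_matrix_closed[OF A] pow_carrier_mat[OF char_matrix_closed[OF A]]
      pow_mat_commute[OF char_matrix_closed[OF A] char_matrix_closed[OF A] char_matrix_commute[OF A], symmetric]] .

lemma pow_mult_vec_eigen:
  fixes A :: "'a :: field mat"
  assumes A: "A \<in> carrier_mat n n" and v: "v \<in> carrier_vec n" and Av: "A *\<^sub>v v = c \<cdot>\<^sub>v v"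
  shows "A ^\<^sub>m k *\<^sub>v v = c ^ k \<cdot>\<^sub>v v"
proof (induction k)
  case 0
  show ?case using A v by simp
next
  case (Suc k)
  have "A ^\<^sub>m k \<in> carrier_mat n n" using A by simp
  then show ?case
    using A v by (simp add: assoc_mult_mat_vec[of _ n n _ n] Av mult_mat_vec[of _ n n] Suc smult_smult_assoc)
qed

lemma finite_eigenvalues:
  fixes A :: "'a :: field mat"
  assumes A: "A \<in> carrier_mat n n"
  shows "finite {z. eigenvalue A z}"
proof -
  have "char_poly A \<noteq> 0"
    using degree_monic_char_poly[OF A] by auto
  then show ?thesis
    by (simp add: eigenvalue_root_char_poly[OF A] poly_roots_finite)
qed

abbreviation generalized_eigenvectors :: "nat \<Rightarrow> complex mat \<Rightarrow> complex set \<Rightarrow> complex vec set" where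
  "generalized_eigenvectors n A \<Lambda> \<equiv> 
    (\<Union>z \<in> {z \<in> \<Lambda>. eigenvalue A z}. mat_kernel (char_matrix A z ^\<^sub>m n))"

lemma generalized_eigenvectors_carrier:
  assumes A: "A \<in> carrier_mat n n"
  shows "generalized_eigenvectors n A \<Lambda> \<subseteq> carrier_vec n"
proof -
  have "char_matrix A z ^\<^sub>m n \<in> carrier_mat n n" for z
    using A by (intro pow_carrier_mat char_matrix_closed)
  then show ?thesis
    using mat_kernelD(1) by blast
qed

text \<open>The set is the preimage of a complex span under complexification, which is additive and
  compatible with real scalars.\<close>

lemma subspace_spectral_subspace:
  assumes M: "M \<in> carrier_mat n n"
  shows "subspace class_ring (spectral_subspace n M \<Lambda>) (module_vec TYPE(real) n)"
proof -
  interpret vs: vec_space "TYPE(real)" n .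
  interpret vc: vec_space "TYPE(complex)" n .
  let ?G = "generalized_eigenvectors n (map_mat complex_of_real M) \<Lambda>"
  have "submodule class_ring (vc.span ?G) (module_vec TYPE(complex) n)"
    using vc.span_is_submodule generalized_eigenvectors_carrier M by simp
  then interpret G: submodule class_ring "vc.span ?G" "module_vec TYPE(complex) n" .
  have mem: "v \<in> spectral_subspace n M \<Lambda> \<longleftrightarrow> v \<in> carrier_vec n \<and> map_vec complex_of_real v \<in> vc.span ?G" for v
    by (simp add: spectral_subspace_def)
  have "submodule class_ring (spectral_subspace n M \<Lambda>) (module_vec TYPE(real) n)"
  proof (unfold_locales, goal_cases)
    case 1
    show ?case by (auto simp: mem module_vec_simps)
  next
    case (2 v w)
    then have "map_vec complex_of_real (v + w) = map_vec complex_of_real v + map_vec complex_of_real w"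
      by (intro eq_vecI) (auto simp: mem)
    with 2 G.m_closed show ?case by (simp add: mem module_vec_simps)
  next
    case 3
    have zero: "map_vec complex_of_real (0\<^sub>v n) = 0\<^sub>v n"
      by (intro eq_vecI) auto
    show ?case
      using G.zero_closed[unfolded module_vec_simps] by (simp add: mem module_vec_simps zero)
  next
    case (4 c v)
    then have "map_vec complex_of_real (c \<cdot>\<^sub>v v) = complex_of_real c \<cdot>\<^sub>v map_vec complex_of_real v"
      by (intro eq_vecI) (auto simp: mem)
    with 4 G.smult_closed[of "complex_of_real c"] show ?case by (simp add: mem module_vec_simps)
  qed
  then show ?thesis
    using vs.vectorspace_axioms by (simp add: subspace_def)
qed

text \<open>
  The product of the \<open>(A - z I)\<^sup>n\<close> annihilates all generalized eigenvectors, whereas it acts on the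
  kernel of \<open>A\<close> as multiplication by the product of the \<open>(- z)\<^sup>n\<close>.
\<close>

definition char_matrix_prod :: "nat \<Rightarrow> complex mat \<Rightarrow> complex list \<Rightarrow> complex mat" where
  "char_matrix_prod n A zs = foldr (\<lambda>z P. char_matrix A z ^\<^sub>m n * P) zs (1\<^sub>m n)"

lemma char_matrix_prod_carrier:
  assumes A: "A \<in> carrier_mat n n"
  shows "char_matrix_prod n A zs \<in> carrier_mat n n"
  unfolding char_matrix_prod_def
  by (induction zs) (auto intro!: mult_carrier_mat pow_carrier_mat char_matrix_closed A)

text \<open>The factor of \<open>z\<close> may stand anywhere in the product; it commutes with the
  factors behind it (\<open>comm\<close>), hence can be moved next to \<open>v\<close>.\<close>

lemma char_matrix_prod_annihilates:
  assumes A: "A \<in> carrier_mat n n" and v: "v \<in> carrier_vec n"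
    and z: "z \<in> set zs" and 0: "char_matrix A z ^\<^sub>m n *\<^sub>v v = 0\<^sub>v n"
  shows "char_matrix_prod n A zs *\<^sub>v v = 0\<^sub>v n"
proof -
  have C: "char_matrix A z ^\<^sub>m n \<in> carrier_mat n n" for z
    by (intro pow_carrier_mat char_matrix_closed A)
  have P: "char_matrix_prod n A zs \<in> carrier_mat n n" for zs
    using A by (rule char_matrix_prod_carrier)
  have comm: "char_matrix A z ^\<^sub>m n * char_matrix_prod n A zs = char_matrix_prod n A zs * char_matrix A z ^\<^sub>m n" for zs
  proof (induction zs)
    case Nil
    show ?case
      by (simp add: char_matrix_prod_def left_mult_one_mat[OF C] right_mult_one_mat[OF C])
  next
    case (Cons w zs)
    have "char_matrix_prod n A (w # zs) = char_matrix A w ^\<^sub>m n * char_matrix_prod n A zs"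
      by (simp add: char_matrix_prod_def)
    then show ?case
      using assoc_mult_mat[OF C C P, of z w zs] assoc_mult_mat[OF C C P, of w z zs] 
        assoc_mult_mat[OF C P C, of w zs z] char_matrix_pow_commute[OF A, of z n w n] Cons
      by simp
  qed
  show ?thesis
    using z
  proof (induction zs)
    case (Cons w zs)
    have eq: "char_matrix_prod n A (w # zs) = char_matrix A w ^\<^sub>m n * char_matrix_prod n A zs"
      by (simp add: char_matrix_prod_def)
    show ?case
    proof (cases "z = w")
      case True
      then show ?thesis
        unfolding eq using comm[of zs] 0 assoc_mult_mat_vec[OF P C v, of zs z] P[of zs] by simp
    next
      case False
      then show ?thesis
        unfolding eq using Cons assoc_mult_mat_vec[OF C P v, of w zs] C[of w] by simp
    qed
  qed simp
qed

lemma char_matrix_prod_kernel: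
  assumes A: "A \<in> carrier_mat n n" and v: "v \<in> carrier_vec n" and 0: "A *\<^sub>v v = 0\<^sub>v n"
  shows "char_matrix_prod n A zs *\<^sub>v v = (\<Prod>z\<leftarrow>zs. (- z) ^ n) \<cdot>\<^sub>v v"
proof (induction zs)
  case Nil
  show ?case using v by (simp add: char_matrix_prod_def)
next
  case (Cons w zs)
  have C: "char_matrix A w ^\<^sub>m n \<in> carrier_mat n n"
    by (intro pow_carrier_mat char_matrix_closed A)
  have P: "char_matrix_prod n A zs \<in> carrier_mat n n"
    using A by (rule char_matrix_prod_carrier)
  have "char_matrix A w *\<^sub>v v = A *\<^sub>v v + ((- w) \<cdot>\<^sub>m 1\<^sub>m n) *\<^sub>v v"
    unfolding char_matrix_def using A v by (subst add_mult_distrib_mat_vec) auto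
  also have "((- w) \<cdot>\<^sub>m 1\<^sub>m n) *\<^sub>v v = (- w) \<cdot>\<^sub>v v"
    using v by (intro eq_vecI) (auto simp: smult_scalar_prod_distrib[of _ n])
  finally have "char_matrix A w *\<^sub>v v = (- w) \<cdot>\<^sub>v v"
    using v by (simp add: 0)
  then have "char_matrix A w ^\<^sub>m n *\<^sub>v v = (- w) ^ n \<cdot>\<^sub>v v"
    by (intro pow_mult_vec_eigen[OF char_matrix_closed[OF A] v])
  moreover have "char_matrix_prod n A (w # zs) = char_matrix A w ^\<^sub>m n * char_matrix_prod n A zs"
    by (simp add: char_matrix_prod_def)
  ultimately show ?case
    using C P v by (simp add: Cons mult_mat_vec[OF C v] smult_smult_assoc mult.commute)
qed

text \<open>A vector in both sets is killed by the product and also multiplied by \<open>c\<close>,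
  a product of powers of nonzero numbers because 0 is not in \<open>\<Lambda>\<close>. The lemma
  serves to show that \<open>Du\<close> is invertible.\<close>

lemma spectral_subspace_kernel:
  assumes M: "M \<in> carrier_mat n n" and \<Lambda>: "0 \<notin> \<Lambda>"
    and v: "v \<in> spectral_subspace n M \<Lambda>" and Mv: "M *\<^sub>v v = 0\<^sub>v n"
  shows "v = 0\<^sub>v n"
proof -
  interpret vc: vec_space "TYPE(complex)" n .
  let ?M = "map_mat complex_of_real M" and ?v = "map_vec complex_of_real v"
  have MM: "?M \<in> carrier_mat n n" using M by simp
  have vv: "v \<in> carrier_vec n" "?v \<in> carrier_vec n" "?v \<in> vc.span (generalized_eigenvectors n ?M \<Lambda>)"
    using v by (auto simp: spectral_subspace_def)
  obtain zs where zs: "set zs = {z \<in> \<Lambda>. eigenvalue ?M z}"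
    using finite_list[of "{z \<in> \<Lambda>. eigenvalue ?M z}"] finite_eigenvalues[OF MM] by auto
  let ?P = "char_matrix_prod n ?M zs"
  have P: "?P \<in> carrier_mat n n"
    using MM by (rule char_matrix_prod_carrier)
  have C: "char_matrix ?M z ^\<^sub>m n \<in> carrier_mat n n" for z
    by (intro pow_carrier_mat char_matrix_closed MM)
  have "x \<in> mat_kernel ?P" if "z \<in> set zs" "x \<in> mat_kernel (char_matrix ?M z ^\<^sub>m n)" for x z
    using mat_kernelD[OF C that(2)] char_matrix_prod_annihilates[OF MM _ that(1)]
    by (intro mat_kernelI[OF P]) simp_all
  then have "generalized_eigenvectors n ?M \<Lambda> \<subseteq> mat_kernel ?P"
    using zs by auto
  \<comment> \<open>A kernel is a submodule, so annihilation passes from the generalized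
    eigenvectors to their span.\<close>
  moreover have "submodule class_ring (mat_kernel ?P) (module_vec TYPE(complex) n)"
    using P by unfold_locales
      (auto simp: module_vec_simps mat_kernel_def mult_add_distrib_mat_vec[of _ n n] mult_mat_vec[of _ n n])
  ultimately have "vc.span (generalized_eigenvectors n ?M \<Lambda>) \<subseteq> mat_kernel ?P"
    by (rule vc.span_is_subset)
  then have "?P *\<^sub>v ?v = 0\<^sub>v n"
    using vv mat_kernelD(2)[OF P] by blast
  moreover define c where "c = (\<Prod>z\<leftarrow>zs. (- z) ^ n)"
  moreover have "?M *\<^sub>v ?v = 0\<^sub>v n"
    using of_real_hom.mult_mat_vec_hom[OF M vv(1), symmetric] by (simp add: Mv of_real_hom.vec_hom_zero)
  ultimately have cv: "c \<cdot>\<^sub>v ?v = 0\<^sub>v n"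
    using char_matrix_prod_kernel[OF MM vv(2)] by simp
  have "c \<noteq> 0"
  proof
    assume "c = 0"
    then obtain z where "z \<in> set zs" "(- z) ^ n = 0"
      by (auto simp: c_def prod_list_zero_iff)
    then have "0 \<in> set zs" by simp
    then show False using \<Lambda> zs by blast
  qed
  then have "v $ i = 0" if "i < n" for i
    using arg_cong[OF cv, of "\<lambda>u. u $ i"] that vv(1) by simp
  then show ?thesis
    using vv(1) by (intro eq_vecI) auto
qed

section \<open>Block columns, projectors and coordinate blocks\<close>

lemma append_columns_carrier:
  assumes "A \<in> carrier_mat n r" "B \<in> carrier_mat n s"
  shows "append_columns A B \<in> carrier_mat n (r + s)"
  using assms unfolding append_columns_def by auto

lemma append_columns_mult_vec:
  assumes A: "A \<in> carrier_mat n r" and B: "B \<in> carrier_mat n s"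
    and a: "a \<in> carrier_vec r" and c: "c \<in> carrier_vec s"
  shows "append_columns A B *\<^sub>v (a @\<^sub>v c) = A *\<^sub>v a + B *\<^sub>v c"
  unfolding append_columns_def using A B
  by (subst four_block_mat_mult_vec[OF A B _ _ a c]) auto

lemma append_columns_invertible:
  assumes U: "U \<in> carrier_mat n r" and V: "V \<in> carrier_mat n s" and rs: "r + s = n"
    and inj: "\<And>a c. a \<in> carrier_vec r \<Longrightarrow> c \<in> carrier_vec s \<Longrightarrow> U *\<^sub>v a + V *\<^sub>v c = 0\<^sub>v n \<Longrightarrow>
      a = 0\<^sub>v r \<and> c = 0\<^sub>v s"
  shows "invertible_mat (append_columns U V)"
proof (rule invertible_matI_inj)
  show "append_columns U V \<in> carrier_mat n n"
    using append_columns_carrier[OF U V] by (simp add: rs)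
  fix x assume x: "x \<in> carrier_vec n" and "append_columns U V *\<^sub>v x = 0\<^sub>v n"
  moreover have x_eq: "vec_first x r @\<^sub>v vec_last x s = x"
    using x rs by simp
  ultimately have "U *\<^sub>v vec_first x r + V *\<^sub>v vec_last x s = 0\<^sub>v n"
    using append_columns_mult_vec[OF U V vec_first_carrier vec_last_carrier, of x x] by simp
  from inj[OF vec_first_carrier vec_last_carrier this] have "x = 0\<^sub>v r @\<^sub>v 0\<^sub>v s"
    using x_eq by simp
  then show "x = 0\<^sub>v n"
    using rs by auto
qed

lemma pow_mat_mult_vec_Suc:
  fixes A :: "'a :: comm_ring_1 mat"
  assumes A: "A \<in> carrier_mat n n" and v: "v \<in> carrier_vec n"
  shows "A ^\<^sub>m Suc k *\<^sub>v v = A ^\<^sub>m k *\<^sub>v (A *\<^sub>v v)"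
    and "A ^\<^sub>m Suc k *\<^sub>v v = A *\<^sub>v (A ^\<^sub>m k *\<^sub>v v)"
proof -
  have k: "A ^\<^sub>m k \<in> carrier_mat n n" using A by simp
  show "A ^\<^sub>m Suc k *\<^sub>v v = A ^\<^sub>m k *\<^sub>v (A *\<^sub>v v)"
    using assoc_mult_mat_vec[OF k A v] by simp
  show "A ^\<^sub>m Suc k *\<^sub>v v = A *\<^sub>v (A ^\<^sub>m k *\<^sub>v v)"
    using assoc_mult_mat_vec[OF A k v] pow_mat_commute[OF A A refl, of k] by simp
qed

lemma eq_matI_mult_vec:
  fixes A B :: "'a :: comm_ring_1 mat"
  assumes A: "A \<in> carrier_mat n m" and B: "B \<in> carrier_mat n m"
    and eq: "\<And>v. v \<in> carrier_vec m \<Longrightarrow> A *\<^sub>v v = B *\<^sub>v v"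
  shows "A = B"
proof (rule eq_matI)
  fix i j assume ij: "i < dim_row B" "j < dim_col B"
  then have "(A *\<^sub>v unit_vec m j) $ i = (B *\<^sub>v unit_vec m j) $ i"
    by (simp add: eq)
  then show "A $$ (i, j) = B $$ (i, j)"
    using ij A B by (simp add: scalar_prod_right_unit)
qed (use A B in auto)

text \<open>\<open>projector\<close> is a definite description, so nothing is known about it before
  existence and uniqueness are proved; invertibility of \<open>[U V]\<close> gives both.\<close>

lemma projector_eq:
  assumes U: "U \<in> carrier_mat n r" and V: "V \<in> carrier_mat n s" and rs: "r + s = n"
    and inv: "invertible_mat (append_columns U V)"
    and E: "E = {U *\<^sub>v a | a. a \<in> carrier_vec r}" and F: "F = {V *\<^sub>v c | c. c \<in> carrier_vec s}"
  shows "projector n E F \<in> carrier_mat n n"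
    and "\<And>a c. a \<in> carrier_vec r \<Longrightarrow> c \<in> carrier_vec s \<Longrightarrow> projector n E F *\<^sub>v (U *\<^sub>v a + V *\<^sub>v c) = U *\<^sub>v a"
proof -
  let ?W = "append_columns U V"
  \<comment> \<open>The inverse of \<open>[U V]\<close> reads off the coordinates
    \<open>(a, c)\<close>, and \<open>[U 0]\<close> rebuilds only the component in
    \<open>E\<close>.\<close>
  let ?P = "append_columns U (0\<^sub>m n s) * mat_inv ?W"
  define is_proj where "is_proj P \<longleftrightarrow> P \<in> carrier_mat n n \<and> (\<forall>v \<in> E. P *\<^sub>v v = v) \<and> (\<forall>v \<in> F. P *\<^sub>v v = 0\<^sub>v n)" for P
  have W: "?W \<in> carrier_mat n n"
    using append_columns_carrier[OF U V] rs by simp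
  note W_inv = invertible_matE[OF inv W]
  have U0: "append_columns U (0\<^sub>m n s) \<in> carrier_mat n n"
    using append_columns_carrier[OF U, of "0\<^sub>m n s" s] rs by simp
  have inv_W: "mat_inv ?W *\<^sub>v (U *\<^sub>v a + V *\<^sub>v c) = a @\<^sub>v c" if "a \<in> carrier_vec r" "c \<in> carrier_vec s" for a c
  proof -
    have ac: "a @\<^sub>v c \<in> carrier_vec n" using that rs by auto
    have "mat_inv ?W *\<^sub>v (?W *\<^sub>v (a @\<^sub>v c)) = (mat_inv ?W * ?W) *\<^sub>v (a @\<^sub>v c)"
      using assoc_mult_mat_vec[OF W_inv(2) W ac] by simp
    then show ?thesis
      unfolding W_inv(4) append_columns_mult_vec[OF U V that] one_mult_mat_vec[OF ac] .
  qed
  have act: "?P *\<^sub>v (U *\<^sub>v a + V *\<^sub>v c) = U *\<^sub>v a" if ac: "a \<in> carrier_vec r" "c \<in> carrier_vec s" for a c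
  proof -
    have "U *\<^sub>v a + V *\<^sub>v c \<in> carrier_vec n"
      using U V ac by auto
    then have "?P *\<^sub>v (U *\<^sub>v a + V *\<^sub>v c) = append_columns U (0\<^sub>m n s) *\<^sub>v (a @\<^sub>v c)"
      using assoc_mult_mat_vec[OF U0 W_inv(2)] by (simp add: inv_W[OF ac])
    also have "\<dots> = U *\<^sub>v a"
      using append_columns_mult_vec[OF U zero_carrier_mat ac] U ac by (intro eq_vecI) auto
    finally show ?thesis .
  qed
  have "is_proj ?P"
    unfolding is_proj_def
  proof (intro conjI ballI)
    show "?P \<in> carrier_mat n n"
      using U0 W_inv(2) by simp
  next
    fix v assume "v \<in> E"
    then obtain a where "a \<in> carrier_vec r" "v = U *\<^sub>v a" using E by auto
    then show "?P *\<^sub>v v = v"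
      using act[of a "0\<^sub>v s"] U V by simp
  next
    fix v assume "v \<in> F"
    then obtain c where "c \<in> carrier_vec s" "v = V *\<^sub>v c" using F by auto
    then show "?P *\<^sub>v v = 0\<^sub>v n"
      using act[of "0\<^sub>v r" c] U V by simp
  qed
  moreover have "P = ?P" if P: "is_proj P" for P
  proof (rule eq_matI_mult_vec)
    show "P \<in> carrier_mat n n" "?P \<in> carrier_mat n n"
      using P U0 W_inv(2) by (auto simp: is_proj_def)
    fix v :: "real vec" assume v: "v \<in> carrier_vec n"
    define x where "x = mat_inv ?W *\<^sub>v v"
    have x: "x \<in> carrier_vec (r + s)"
      using v W_inv(2) rs by (simp add: x_def)
    have "?W *\<^sub>v x = v"
      using assoc_mult_mat_vec[OF W W_inv(2) v] unfolding x_def W_inv(3) one_mult_mat_vec[OF v] by (rule sym)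
    then have v_eq: "v = U *\<^sub>v vec_first x r + V *\<^sub>v vec_last x s"
      using append_columns_mult_vec[OF U V vec_first_carrier vec_last_carrier, of x x]
      unfolding vec_first_last_append[OF x] by (rule trans[OF sym])
    have "P *\<^sub>v v = P *\<^sub>v (U *\<^sub>v vec_first x r) + P *\<^sub>v (V *\<^sub>v vec_last x s)"
      using P U V unfolding v_eq is_proj_def by (intro mult_add_distrib_mat_vec) auto
    also have "\<dots> = U *\<^sub>v vec_first x r"
    proof -
      have "U *\<^sub>v vec_first x r \<in> E" "V *\<^sub>v vec_last x s \<in> F"
        using E F by auto
      then show ?thesis using P U by (simp add: is_proj_def)
    qed
    also have "\<dots> = ?P *\<^sub>v v"
      unfolding v_eq by (intro act[symmetric]) auto
    finally show "P *\<^sub>v v = ?P *\<^sub>v v" .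
  qed
  ultimately have "projector n E F = ?P"
    unfolding projector_def is_proj_def[symmetric] by (intro the_equality)
  then show "projector n E F \<in> carrier_mat n n"
    and "\<And>a c. a \<in> carrier_vec r \<Longrightarrow> c \<in> carrier_vec s \<Longrightarrow> projector n E F *\<^sub>v (U *\<^sub>v a + V *\<^sub>v c) = U *\<^sub>v a"
    using U0 W_inv(2) act by auto
qed

text \<open>The factor must be the same for all splittings of \<open>n\<close>, since the dimensions
  of the spectral subspaces are not among the quantities on which the Green constant may
  depend.\<close>

lemma vnorm_split_le:
  assumes norms: "\<And>k. is_vec_norm k (\<nu> k)"
  shows "\<exists>\<kappa>\<ge>0. \<forall>r s. r + s = n \<longrightarrow> (\<forall>a \<in> carrier_vec r. \<forall>c \<in> carrier_vec s.
    \<nu> r a \<le> \<kappa> * \<nu> n (a @\<^sub>v c) \<and> \<nu> s c \<le> \<kappa> * \<nu> n (a @\<^sub>v c))"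
proof -
  have "\<exists>d\<ge>0. \<forall>x \<in> carrier_vec n. \<nu> r (vec_first x r) + \<nu> (n - r) (vec_last x (n - r)) \<le> d * \<nu> n x"
    if r: "r \<le> n" for r
  proof (rule seminorm_le_vnorm[OF norms])
    fix x y :: "real vec" and c :: real
    assume x: "x \<in> carrier_vec n"
    have "vec_first (c \<cdot>\<^sub>v x) r = c \<cdot>\<^sub>v vec_first x r" "vec_last (c \<cdot>\<^sub>v x) (n - r) = c \<cdot>\<^sub>v vec_last x (n - r)"
      using r x by (auto simp: vec_first_def vec_last_def)
    then show "\<nu> r (vec_first (c \<cdot>\<^sub>v x) r) + \<nu> (n - r) (vec_last (c \<cdot>\<^sub>v x) (n - r)) =
        \<bar>c\<bar> * (\<nu> r (vec_first x r) + \<nu> (n - r) (vec_last x (n - r)))"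
      by (simp add: vnorm_smult[OF norms] distrib_left)
    assume y: "y \<in> carrier_vec n"
    have "vec_first (x + y) r = vec_first x r + vec_first y r"
      "vec_last (x + y) (n - r) = vec_last x (n - r) + vec_last y (n - r)"
      using r x y by (auto simp: vec_first_def vec_last_def)
    then show "\<nu> r (vec_first (x + y) r) + \<nu> (n - r) (vec_last (x + y) (n - r)) \<le>
        \<nu> r (vec_first x r) + \<nu> (n - r) (vec_last x (n - r)) + (\<nu> r (vec_first y r) + \<nu> (n - r) (vec_last y (n - r)))"
      using vnorm_add[OF norms vec_first_carrier[of x r] vec_first_carrier[of y r]]
        vnorm_add[OF norms vec_last_carrier[of x "n - r"] vec_last_carrier[of y "n - r"]] by simp
  qed
  then have "\<forall>r. \<exists>d. r \<le> n \<longrightarrow>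
      d \<ge> 0 \<and> (\<forall>x \<in> carrier_vec n. \<nu> r (vec_first x r) + \<nu> (n - r) (vec_last x (n - r)) \<le> d * \<nu> n x)"
    by blast
  from choice[OF this] obtain d where d: "\<And>r. r \<le> n \<Longrightarrow> d r \<ge> 0"
    "\<And>r x. r \<le> n \<Longrightarrow> x \<in> carrier_vec n \<Longrightarrow> \<nu> r (vec_first x r) + \<nu> (n - r) (vec_last x (n - r)) \<le> d r * \<nu> n x"
    by blast
  \<comment> \<open>Only the \<open>n + 1\<close> values of \<open>r\<close> up to \<open>n\<close>
    occur, so the sum of their constants serves every splitting.\<close>
  define \<kappa> where "\<kappa> = (\<Sum>r\<le>n. d r)"
  have "0 \<le> \<kappa>"
    unfolding \<kappa>_def by (intro sum_nonneg) (simp add: d(1))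
  moreover have "\<nu> r a \<le> \<kappa> * \<nu> n (a @\<^sub>v c) \<and> \<nu> s c \<le> \<kappa> * \<nu> n (a @\<^sub>v c)"
    if rs: "r + s = n" and a: "a \<in> carrier_vec r" and c: "c \<in> carrier_vec s" for r s a c
  proof -
    have ac: "a @\<^sub>v c \<in> carrier_vec n" using rs a c by auto
    have "vec_first (a @\<^sub>v c) r = a" "vec_last (a @\<^sub>v c) s = c"
      using a c by (auto simp: vec_first_def vec_last_def)
    moreover have "n - r = s" "r \<le> n" using rs by auto
    ultimately have "\<nu> r a + \<nu> s c \<le> d r * \<nu> n (a @\<^sub>v c)"
      using d(2)[of r, OF _ ac] by simp
    also have "\<dots> \<le> \<kappa> * \<nu> n (a @\<^sub>v c)"
      unfolding \<kappa>_def using d(1) rs vnorm_nonneg[OF norms ac] by (intro mult_right_mono member_le_sum) auto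
    finally show ?thesis
      using vnorm_nonneg[OF norms a] vnorm_nonneg[OF norms c] by simp
  qed
  ultimately show ?thesis by blast
qed

text \<open>The induction is for all \<open>k\<close> at once because a step raises the power:
  \<open>D^k x_{t+1} = D^{k+1} x_t + D^k y_t\<close>. The exponent contains \<open>t - 1 - j\<close>
  since \<open>y j\<close> first acts at time \<open>j + 1\<close>. The abstract weight
  \<open>g\<close> lets the bound serve both directions of time.\<close>

lemma orbit_bound:
  assumes norms: "\<And>k. is_vec_norm k (\<nu> k)"
    and V: "V \<in> carrier_mat n m" and D: "D \<in> carrier_mat m m"
    and x: "\<And>j. x j \<in> carrier_vec m" and y: "\<And>j. y j \<in> carrier_vec m"
    and step: "\<And>j. x (Suc j) = D *\<^sub>v x j + y j"
    and x0: "\<And>k. \<nu> n (V *\<^sub>v (D ^\<^sub>m k *\<^sub>v x 0)) \<le> K * exp (- \<gamma> * real k) * \<nu> m (x 0)"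
    and yj: "\<And>k j. \<nu> n (V *\<^sub>v (D ^\<^sub>m k *\<^sub>v y j)) \<le> exp (- \<gamma> * real k) * g j"
  shows "\<nu> n (V *\<^sub>v (D ^\<^sub>m k *\<^sub>v x t)) \<le> K * exp (- \<gamma> * (real k + real t)) * \<nu> m (x 0) +
    (\<Sum>j<t. exp (- \<gamma> * (real k + real t - 1 - real j)) * g j)"
proof (induction t arbitrary: k)
  case 0
  show ?case using x0[of k] by simp
next
  case (Suc t)
  have Dk: "D ^\<^sub>m k \<in> carrier_mat m m" using D by simp
  have "D ^\<^sub>m k *\<^sub>v x (Suc t) = D ^\<^sub>m Suc k *\<^sub>v x t + D ^\<^sub>m k *\<^sub>v y t"
    unfolding step using D x y
    by (simp only: mult_add_distrib_mat_vec[OF Dk mult_mat_vec_carrier[OF D x] y] pow_mat_mult_vec_Suc(1)[OF D x])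
  moreover have c: "D ^\<^sub>m Suc k *\<^sub>v x t \<in> carrier_vec m" "D ^\<^sub>m k *\<^sub>v y t \<in> carrier_vec m"
    using mult_mat_vec_carrier[OF pow_carrier_mat[OF D]] x y by blast+
  ultimately have "V *\<^sub>v (D ^\<^sub>m k *\<^sub>v x (Suc t)) = V *\<^sub>v (D ^\<^sub>m Suc k *\<^sub>v x t) + V *\<^sub>v (D ^\<^sub>m k *\<^sub>v y t)"
    by (simp only: mult_add_distrib_mat_vec[OF V c])
  then have "\<nu> n (V *\<^sub>v (D ^\<^sub>m k *\<^sub>v x (Suc t))) \<le> \<nu> n (V *\<^sub>v (D ^\<^sub>m Suc k *\<^sub>v x t)) + \<nu> n (V *\<^sub>v (D ^\<^sub>m k *\<^sub>v y t))"
    using vnorm_add[OF norms mult_mat_vec_carrier[OF V c(1)] mult_mat_vec_carrier[OF V c(2)]] by simp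
  also have "\<dots> \<le> \<nu> n (V *\<^sub>v (D ^\<^sub>m Suc k *\<^sub>v x t)) + exp (- \<gamma> * real k) * g t"
    using yj by simp
  also note Suc[of "Suc k"]
  finally show ?case by (simp add: algebra_simps)
qed

text \<open>A basis is a set, which cannot see repeated columns; distinctness of the columns turns
  linear independence of the set into injectivity of \<open>V\<close>.\<close>

lemma columns_basis_inj:
  assumes E: "subspace class_ring E (module_vec TYPE(real) n)"
    and V: "columns_basis n E V"
    and c: "c \<in> carrier_vec (dim_col V)" and Vc: "V *\<^sub>v c = 0\<^sub>v n"
  shows "c = 0\<^sub>v (dim_col V)"
proof (rule ccontr)
  assume c0: "c \<noteq> 0\<^sub>v (dim_col V)"
  interpret vs: vec_space "TYPE(real)" n .
  have VS: "vectorspace class_ring (subspace_of n E)"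
    using vs.subspace_is_vs[OF E] .
  have VV: "V \<in> carrier_mat n (dim_col V)" and dist: "distinct (cols V)"
    using V by (auto simp: columns_basis_def)
  have li: "\<not> LinearCombinations.module.lin_dep class_ring (subspace_of n E) (set (cols V))"
    and sub: "set (cols V) \<subseteq> E"
    using V unfolding columns_basis_def by (auto simp: vectorspace.basis_def[OF VS])
  have sm: "submodule class_ring E vs.V"
    using E by (simp add: subspace_def)
  have "vs.lin_dep (set (cols V))"
    by (rule vs.lin_depI[OF VV c c0 Vc dist])
  with li show False
    unfolding vs.span_li_not_depend(2)[OF sub sm] by (rule notE)
qed

section \<open>Perturbation of the boundary matrix\<close>

text \<open>No series is summed: writing \<open>G x = H x - (H - G) x\<close> gives the lower bound
  \<open>bound\<close> for \<open>H\<close>. It implies injectivity, hence invertibility of a square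
  matrix, and, applied to \<open>mat_inv H *\<^sub>v y\<close>, the norm estimate.\<close>

lemma perturbed_inverse:
  assumes norms: "\<And>k. is_vec_norm k (\<nu> k)"
    and G: "G \<in> carrier_mat n n" and inv: "invertible_mat G" and H: "H \<in> carrier_mat n n"
    and q: "op_norm \<nu> (mat_inv G) * op_norm \<nu> (H - G) \<le> q" "q < 1"
  shows "invertible_mat H" and "op_norm \<nu> (mat_inv H) \<le> op_norm \<nu> (mat_inv G) / (1 - q)"
proof -
  note G_inv = invertible_matE[OF inv G]
  have HG: "H - G \<in> carrier_mat n n" by (rule minus_carrier_mat[OF G])
  have bound: "(1 - q) * \<nu> n x \<le> op_norm \<nu> (mat_inv G) * \<nu> n (H *\<^sub>v x)" if x: "x \<in> carrier_vec n" for x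
  proof -
    have Hx: "H *\<^sub>v x \<in> carrier_vec n" and Dx: "(H - G) *\<^sub>v x \<in> carrier_vec n" and Gx: "G *\<^sub>v x \<in> carrier_vec n"
      using mult_mat_vec_carrier H HG G x by blast+
    have "x = mat_inv G *\<^sub>v (G *\<^sub>v x)"
      using assoc_mult_mat_vec[OF G_inv(2) G x] unfolding G_inv(4) one_mult_mat_vec[OF x] .
    then have "\<nu> n x \<le> op_norm \<nu> (mat_inv G) * \<nu> n (G *\<^sub>v x)"
      using vnorm_mult_mat_vec_le[OF norms G_inv(2) Gx] by simp
    also have "G *\<^sub>v x = H *\<^sub>v x - (H - G) *\<^sub>v x"
      using Hx Gx unfolding minus_mult_distrib_mat_vec[OF H G x] by (intro eq_vecI) auto
    also have "\<nu> n (H *\<^sub>v x - (H - G) *\<^sub>v x) \<le> \<nu> n (H *\<^sub>v x) + op_norm \<nu> (H - G) * \<nu> n x"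
      using vnorm_diff[OF norms Hx Dx] vnorm_mult_mat_vec_le[OF norms HG x] by simp
    finally have "\<nu> n x \<le> op_norm \<nu> (mat_inv G) * (\<nu> n (H *\<^sub>v x) + op_norm \<nu> (H - G) * \<nu> n x)"
      using op_norm_nonneg[OF norms] by (simp add: mult_left_mono)
    moreover have "op_norm \<nu> (mat_inv G) * op_norm \<nu> (H - G) * \<nu> n x \<le> q * \<nu> n x"
      using q(1) vnorm_nonneg[OF norms x] by (rule mult_right_mono)
    ultimately show ?thesis by (simp add: algebra_simps)
  qed
  show inv_H: "invertible_mat H"
  proof (rule invertible_matI_inj[OF H])
    fix x assume x: "x \<in> carrier_vec n" and "H *\<^sub>v x = 0\<^sub>v n"
    then have "(1 - q) * \<nu> n x \<le> 0"
      using bound[OF x] by (simp add: vnorm_zero[OF norms])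
    then show "x = 0\<^sub>v n"
      using q(2) vnorm_nonneg[OF norms x] vnorm_eq_0_iff[OF norms x] by (simp add: mult_le_0_iff)
  qed
  note H_inv = invertible_matE[OF inv_H H]
  show "op_norm \<nu> (mat_inv H) \<le> op_norm \<nu> (mat_inv G) / (1 - q)"
  proof (rule op_norm_le[OF norms H_inv(2)])
    show "0 \<le> op_norm \<nu> (mat_inv G) / (1 - q)"
      using op_norm_nonneg[OF norms] q(2) by simp
    fix y :: "real vec" assume y: "y \<in> carrier_vec n"
    have "H *\<^sub>v (mat_inv H *\<^sub>v y) = y"
      using assoc_mult_mat_vec[OF H H_inv(2) y] unfolding H_inv(3) one_mult_mat_vec[OF y] by (rule sym)
    then show "\<nu> n (mat_inv H *\<^sub>v y) \<le> op_norm \<nu> (mat_inv G) / (1 - q) * \<nu> n y"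
      using bound[OF mult_mat_vec_carrier[OF H_inv(2) y]] q(2) by (simp add: field_simps)
  qed
qed

lemma sup_inv_norm_less_infty:
  assumes norms: "\<And>k. is_vec_norm k (\<nu> k)"
    and G: "G \<in> carrier_mat n n" "invertible_mat G" and H: "\<And>N. \<Gamma> N \<in> carrier_mat n n"
    and less: "(SUP N \<in> {Nc..}. ereal (op_norm \<nu> (mat_inv G) * op_norm \<nu> (\<Gamma> N - G))) < 1"
    and inv: "\<And>N. T0 \<le> N \<Longrightarrow> N < Nc \<Longrightarrow> invertible_mat (\<Gamma> N)"
  shows "(\<forall>N\<ge>T0. invertible_mat (\<Gamma> N)) \<and> sup_inv_norm \<nu> \<Gamma> T0 < \<infinity>"
proof -
  let ?S = "SUP N \<in> {Nc..}. ereal (op_norm \<nu> (mat_inv G) * op_norm \<nu> (\<Gamma> N - G))"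
  \<comment> \<open>The strict inequality for the supremum leaves room for one \<open>q < 1\<close>
    valid for all \<open>N \<ge> Nc\<close>; without it \<open>1 / (1 - q)\<close> would not be
    uniform.\<close>
  obtain q where q: "?S < ereal q" "ereal q < 1"
    using ereal_dense2[OF less] by blast
  have le: "op_norm \<nu> (mat_inv G) * op_norm \<nu> (\<Gamma> N - G) \<le> q" if "N \<ge> Nc" for N
  proof -
    have "ereal (op_norm \<nu> (mat_inv G) * op_norm \<nu> (\<Gamma> N - G)) \<le> ?S"
      using that by (intro SUP_upper) simp
    from le_less_trans[OF this q(1)] show ?thesis by simp
  qed
  have q1: "q < 1" using q(2) by simp
  note pert = perturbed_inverse[OF norms G H le q1]
  have nonneg: "0 \<le> op_norm \<nu> A" for A
    by (rule op_norm_nonneg[OF norms])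
  \<comment> \<open>The sum covers the finitely many horizons below the cutoff. It may include
    singular matrices with \<open>N < T0\<close>; this is harmless because \<open>op_norm\<close> is
    nonnegative for every matrix.\<close>
  define B where "B = op_norm \<nu> (mat_inv G) / (1 - q) + (\<Sum>N<Nc. op_norm \<nu> (mat_inv (\<Gamma> N)))"
  have "op_norm \<nu> (mat_inv (\<Gamma> N)) \<le> B" for N
  proof (cases "N < Nc")
    case True
    then have "op_norm \<nu> (mat_inv (\<Gamma> N)) \<le> (\<Sum>N<Nc. op_norm \<nu> (mat_inv (\<Gamma> N)))"
      using nonneg by (intro member_le_sum) auto
    then show ?thesis
      using nonneg q1 by (simp add: B_def add_increasing)
  next
    case False
    then show ?thesis
      using pert(2)[of N] nonneg by (simp add: B_def add_increasing2 sum_nonneg)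
  qed
  then have "sup_inv_norm \<nu> \<Gamma> T0 \<le> ereal B"
    unfolding sup_inv_norm_def by (intro SUP_least) simp
  then have "sup_inv_norm \<nu> \<Gamma> T0 < \<infinity>"
    by (rule le_less_trans) simp
  moreover have "invertible_mat (\<Gamma> N)" if "T0 \<le> N" for N
    using inv[of N] pert(1)[of N] that by (cases "N < Nc") auto
  ultimately show ?thesis by blast
qed

section \<open>The Green kernel and affine orbits\<close>

lemma green_kernel_nonneg: "0 \<le> green_kernel \<gamma> T t s"
  by (simp add: green_kernel_def)

lemma exp_abs_le_green_kernel: "exp (- \<gamma> * \<bar>real t - real s\<bar>) \<le> green_kernel \<gamma> T t s"
  by (simp add: green_kernel_def)

text \<open>Of the four products, the two mixed ones are the last two terms of the kernel, and each
  of the other two is at most the first term. Hence the factor 2.\<close>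

lemma boundary_weight_mult_le_green_kernel:
  assumes "0 < \<gamma>" "t \<le> T" "s \<le> T"
  shows "(exp (- \<gamma> * real t) + exp (- \<gamma> * (real T - real t))) *
      (exp (- \<gamma> * real s) + exp (- \<gamma> * (real T - real s))) \<le> 2 * green_kernel \<gamma> T t s"
proof -
  have "exp (- \<gamma> * (real t + real s)) \<le> exp (- \<gamma> * \<bar>real t - real s\<bar>)"
    using assms by simp
  moreover have "exp (- \<gamma> * ((real T - real t) + (real T - real s))) \<le> exp (- \<gamma> * \<bar>real t - real s\<bar>)"
    using assms by simp
  moreover have "(exp (- \<gamma> * real t) + exp (- \<gamma> * (real T - real t))) *
      (exp (- \<gamma> * real s) + exp (- \<gamma> * (real T - real s))) =
      exp (- \<gamma> * (real t + real s)) + exp (- \<gamma> * (real t + real T - real s)) +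
      exp (- \<gamma> * (real T - real t + real s)) + exp (- \<gamma> * ((real T - real t) + (real T - real s)))"
    by (simp add: algebra_simps exp_add[symmetric])
  moreover have "0 \<le> exp (- \<gamma> * (real t + real T - real s))" "0 \<le> exp (- \<gamma> * (real T - real t + real s))"
    by simp_all
  moreover have "x \<le> 2 * (k + b + c)"
    if "a \<le> k" "d \<le> k" "x = a + b + c + d" "0 \<le> b" "0 \<le> c" for a b c d k x :: real
    using that by simp
  ultimately show ?thesis unfolding green_kernel_def by blast
qed

text \<open>One recursion for both directions: the stable part runs it with \<open>Ds\<close>, the
  unstable part with the inverse of \<open>Du\<close> in reversed time.\<close>

definition affine_orbit :: "real mat \<Rightarrow> (nat \<Rightarrow> real vec) \<Rightarrow> real vec \<Rightarrow> nat \<Rightarrow> real vec" where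
  "affine_orbit D y x = rec_nat x (\<lambda>j z. D *\<^sub>v z + y j)"

lemma affine_orbit_0 [simp]: "affine_orbit D y x 0 = x"
  and affine_orbit_Suc [simp]: "affine_orbit D y x (Suc j) = D *\<^sub>v affine_orbit D y x j + y j"
  by (simp_all add: affine_orbit_def)

lemma affine_orbit_carrier:
  assumes "D \<in> carrier_mat m m" "x \<in> carrier_vec m" "\<And>j. y j \<in> carrier_vec m"
  shows "affine_orbit D y x j \<in> carrier_vec m"
  using assms by (induction j) auto

text \<open>Superposition separates the free end value from the forcing, which brings the boundary
  condition into a form linear in the end values.\<close>

lemma affine_orbit_split:
  assumes D: "D \<in> carrier_mat m m" and x: "x \<in> carrier_vec m" and y: "\<And>j. y j \<in> carrier_vec m"
  shows "affine_orbit D y x j = D ^\<^sub>m j *\<^sub>v x + affine_orbit D y (0\<^sub>v m) j"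
proof (induction j)
  case 0
  show ?case using D x by simp
next
  case (Suc j)
  have c: "D ^\<^sub>m j *\<^sub>v x \<in> carrier_vec m" "affine_orbit D y (0\<^sub>v m) j \<in> carrier_vec m"
    using mult_mat_vec_carrier[OF pow_carrier_mat[OF D] x] affine_orbit_carrier[OF D _ y] by auto
  have "affine_orbit D y x (Suc j) = (D *\<^sub>v (D ^\<^sub>m j *\<^sub>v x) + D *\<^sub>v affine_orbit D y (0\<^sub>v m) j) + y j"
    by (simp only: affine_orbit_Suc Suc mult_add_distrib_mat_vec[OF D c])
  also have "\<dots> = D ^\<^sub>m Suc j *\<^sub>v x + affine_orbit D y (0\<^sub>v m) (Suc j)"
    unfolding pow_mat_mult_vec_Suc(2)[OF D x] affine_orbit_Suc
    using D c y by (intro assoc_add_vec[of _ m]) auto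
  finally show ?case .
qed

section \<open>The boundary value problem of a dichotomy\<close>

lemma add_vec_swap:
  fixes u v w z :: "'a :: ab_semigroup_add vec"
  assumes "u \<in> carrier_vec n" "v \<in> carrier_vec n" "w \<in> carrier_vec n" "z \<in> carrier_vec n"
  shows "(u + v) + (w + z) = (u + w) + (v + z)"
  using assms by (intro eq_vecI) (auto simp: ac_simps)

text \<open>The spectral data are reduced to two intertwining relations with decay, and
  \<open>S\<close> is any common bound for the inverses from \<open>T0\<close> on. The parameter
  \<open>\<kappa>\<close> compares the norms of coordinate blocks with the norm of the whole
  vector.\<close>

locale dichotomous_bvp =
  fixes \<nu> :: "nat \<Rightarrow> real vec \<Rightarrow> real" and n r s :: nat
    and M Vs Vu Ds Du B\<^sub>0 B\<^sub>T :: "real mat" and K \<gamma> \<kappa> S :: real and T0 :: nat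
  assumes norms: "\<And>k. is_vec_norm k (\<nu> k)"
    and M: "M \<in> carrier_mat n n" and Vs: "Vs \<in> carrier_mat n r" and Vu: "Vu \<in> carrier_mat n s"
    and Ds: "Ds \<in> carrier_mat r r" and Du: "Du \<in> carrier_mat s s"
    and B0: "B\<^sub>0 \<in> carrier_mat n n" and BT: "B\<^sub>T \<in> carrier_mat n n"
    and rs: "r + s = n" and MVs: "M * Vs = Vs * Ds" and MVu: "M * Vu = Vu * Du"
    and Du_inv: "invertible_mat Du" and K: "0 \<le> K" and \<gamma>: "0 < \<gamma>"
    and Ds_bound: "\<And>k. op_norm \<nu> (Vs * (Ds ^\<^sub>m k)) \<le> K * exp (- \<gamma> * real k)"
    and Du_bound: "\<And>k. op_norm \<nu> (Vu * (mat_inv Du ^\<^sub>m k)) \<le> K * exp (- \<gamma> * real k)"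
    and \<Gamma>_inv: "\<And>N. T0 \<le> N \<Longrightarrow> invertible_mat (Gamma_hat B\<^sub>0 B\<^sub>T Vs Vu Ds Du N)"
    and \<Gamma>_bound: "\<And>N. T0 \<le> N \<Longrightarrow> op_norm \<nu> (mat_inv (Gamma_hat B\<^sub>0 B\<^sub>T Vs Vu Ds Du N)) \<le> S"
    and \<kappa>: "0 \<le> \<kappa>"
    and split_le: "\<And>a c. a \<in> carrier_vec r \<Longrightarrow> c \<in> carrier_vec s \<Longrightarrow> \<nu> r a \<le> \<kappa> * \<nu> n (a @\<^sub>v c)"
      "\<And>a c. a \<in> carrier_vec r \<Longrightarrow> c \<in> carrier_vec s \<Longrightarrow> \<nu> s c \<le> \<kappa> * \<nu> n (a @\<^sub>v c)"
begin

abbreviation "\<Gamma> \<equiv> Gamma_hat B\<^sub>0 B\<^sub>T Vs Vu Ds Du"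
abbreviation "W \<equiv> mat_inv Du"
abbreviation "\<beta>\<^sub>0 \<equiv> op_norm \<nu> B\<^sub>0"
abbreviation "\<beta>\<^sub>T \<equiv> op_norm \<nu> B\<^sub>T"

lemmas W = invertible_matE(2)[OF Du_inv Du]

lemma Ds_pow: "Ds ^\<^sub>m k \<in> carrier_mat r r"
  using Ds by simp

lemma W_pow: "W ^\<^sub>m k \<in> carrier_mat s s"
  using W by simp

lemmas mult_carrier [simp] =
  mult_mat_vec_carrier[OF M] mult_mat_vec_carrier[OF Vs] mult_mat_vec_carrier[OF Vu]
  mult_mat_vec_carrier[OF Ds] mult_mat_vec_carrier[OF Du] mult_mat_vec_carrier[OF W]
  mult_mat_vec_carrier[OF B0] mult_mat_vec_carrier[OF BT]
  mult_mat_vec_carrier[OF Ds_pow] mult_mat_vec_carrier[OF W_pow]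

lemma S_nonneg: "0 \<le> S"
  using \<Gamma>_bound[of T0] op_norm_nonneg[OF norms] order_trans by blast

lemma stable_decay:
  assumes "a \<in> carrier_vec r"
  shows "\<nu> n (Vs *\<^sub>v (Ds ^\<^sub>m k *\<^sub>v a)) \<le> K * exp (- \<gamma> * real k) * \<nu> r a"
proof -
  have "\<nu> n ((Vs * Ds ^\<^sub>m k) *\<^sub>v a) \<le> op_norm \<nu> (Vs * Ds ^\<^sub>m k) * \<nu> r a"
    by (rule vnorm_mult_mat_vec_le[OF norms mult_carrier_mat[OF Vs Ds_pow] assms])
  also have "\<dots> \<le> K * exp (- \<gamma> * real k) * \<nu> r a"
    by (rule mult_right_mono[OF Ds_bound vnorm_nonneg[OF norms assms]])
  finally show ?thesis
    unfolding assoc_mult_mat_vec[OF Vs Ds_pow assms] .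
qed

lemma unstable_decay:
  assumes "c \<in> carrier_vec s"
  shows "\<nu> n (Vu *\<^sub>v (W ^\<^sub>m k *\<^sub>v c)) \<le> K * exp (- \<gamma> * real k) * \<nu> s c"
proof -
  have "\<nu> n ((Vu * W ^\<^sub>m k) *\<^sub>v c) \<le> op_norm \<nu> (Vu * W ^\<^sub>m k) * \<nu> s c"
    by (rule vnorm_mult_mat_vec_le[OF norms mult_carrier_mat[OF Vu W_pow] assms])
  also have "\<dots> \<le> K * exp (- \<gamma> * real k) * \<nu> s c"
    by (rule mult_right_mono[OF Du_bound vnorm_nonneg[OF norms assms]])
  finally show ?thesis
    unfolding assoc_mult_mat_vec[OF Vu W_pow assms] .
qed

lemma \<Gamma>_carrier: "\<Gamma> N \<in> carrier_mat n n"
proof -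
  have "\<Gamma> N \<in> carrier_mat n (r + s)"
    unfolding Gamma_hat_def using B0 BT Vs Vu Ds_pow W_pow
    by (intro append_columns_carrier add_carrier_mat mult_carrier_mat[of _ n n] mult_carrier_mat[of _ n r]
        mult_carrier_mat[of _ n s]) auto
  then show ?thesis by (simp add: rs)
qed

text \<open>The meaning of the scaled matrix: its value at \<open>(a, c)\<close> is the boundary
  value of the homogeneous solution whose stable coordinate at time 0 is \<open>a\<close> and whose
  unstable coordinate at time \<open>N\<close> is \<open>c\<close>.\<close>

lemma \<Gamma>_mult_vec:
  assumes a: "a \<in> carrier_vec r" and c: "c \<in> carrier_vec s"
  shows "\<Gamma> N *\<^sub>v (a @\<^sub>v c) =
    B\<^sub>0 *\<^sub>v (Vs *\<^sub>v a + Vu *\<^sub>v (W ^\<^sub>m N *\<^sub>v c)) + B\<^sub>T *\<^sub>v (Vs *\<^sub>v (Ds ^\<^sub>m N *\<^sub>v a) + Vu *\<^sub>v c)"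
proof -
  note [simp] = a c
  have B0Vs: "B\<^sub>0 * Vs \<in> carrier_mat n r" and BTVs: "B\<^sub>T * Vs \<in> carrier_mat n r" 
    and B0Vu: "B\<^sub>0 * Vu \<in> carrier_mat n s" and BTVu: "B\<^sub>T * Vu \<in> carrier_mat n s"
    using B0 BT Vs Vu by auto
  note P = mult_carrier_mat[OF BTVs Ds_pow[of N]] mult_carrier_mat[OF B0Vu W_pow[of N]]
  have "(B\<^sub>0 * Vs + B\<^sub>T * Vs * Ds ^\<^sub>m N) *\<^sub>v a = B\<^sub>0 *\<^sub>v (Vs *\<^sub>v a) + B\<^sub>T *\<^sub>v (Vs *\<^sub>v (Ds ^\<^sub>m N *\<^sub>v a))"
    by (simp add: add_mult_distrib_mat_vec[OF B0Vs P(1) a] assoc_mult_mat_vec[OF BTVs Ds_pow a]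
        assoc_mult_mat_vec[OF B0 Vs] assoc_mult_mat_vec[OF BT Vs])
  moreover have "(B\<^sub>0 * Vu * W ^\<^sub>m N + B\<^sub>T * Vu) *\<^sub>v c = B\<^sub>0 *\<^sub>v (Vu *\<^sub>v (W ^\<^sub>m N *\<^sub>v c)) + B\<^sub>T *\<^sub>v (Vu *\<^sub>v c)"
    by (simp add: add_mult_distrib_mat_vec[OF P(2) BTVu c] assoc_mult_mat_vec[OF B0Vu W_pow c]
        assoc_mult_mat_vec[OF B0 Vu] assoc_mult_mat_vec[OF BT Vu])
  moreover have "\<Gamma> N *\<^sub>v (a @\<^sub>v c) =
    (B\<^sub>0 * Vs + B\<^sub>T * Vs * Ds ^\<^sub>m N) *\<^sub>v a + (B\<^sub>0 * Vu * W ^\<^sub>m N + B\<^sub>T * Vu) *\<^sub>v c"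
    unfolding Gamma_hat_def
    by (rule append_columns_mult_vec[OF add_carrier_mat[OF P(1)] add_carrier_mat[OF BTVu] a c])
  moreover have "B\<^sub>0 *\<^sub>v (Vs *\<^sub>v a + Vu *\<^sub>v (W ^\<^sub>m N *\<^sub>v c)) = B\<^sub>0 *\<^sub>v (Vs *\<^sub>v a) + B\<^sub>0 *\<^sub>v (Vu *\<^sub>v (W ^\<^sub>m N *\<^sub>v c))"
    by (rule mult_add_distrib_mat_vec[OF B0]) simp_all
  moreover have "B\<^sub>T *\<^sub>v (Vs *\<^sub>v (Ds ^\<^sub>m N *\<^sub>v a) + Vu *\<^sub>v c) = B\<^sub>T *\<^sub>v (Vs *\<^sub>v (Ds ^\<^sub>m N *\<^sub>v a)) + B\<^sub>T *\<^sub>v (Vu *\<^sub>v c)"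
    by (rule mult_add_distrib_mat_vec[OF BT]) simp_all
  ultimately show ?thesis
    by (simp only:) (rule add_vec_swap[of _ n]; simp)
qed

lemma vnorm_le_\<Gamma>:
  assumes N: "T0 \<le> N" and x: "x \<in> carrier_vec n"
  shows "\<nu> n x \<le> S * \<nu> n (\<Gamma> N *\<^sub>v x)"
proof -
  note inv = invertible_matE[OF \<Gamma>_inv[OF N] \<Gamma>_carrier[of N]]
  have c: "\<Gamma> N *\<^sub>v x \<in> carrier_vec n" by (rule mult_mat_vec_carrier[OF \<Gamma>_carrier[of N] x])
  have "\<nu> n x = \<nu> n (mat_inv (\<Gamma> N) *\<^sub>v (\<Gamma> N *\<^sub>v x))"
    using assoc_mult_mat_vec[OF inv(2) \<Gamma>_carrier[of N] x] unfolding inv(4) one_mult_mat_vec[OF x] by simp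
  also have "\<dots> \<le> op_norm \<nu> (mat_inv (\<Gamma> N)) * \<nu> n (\<Gamma> N *\<^sub>v x)"
    by (rule vnorm_mult_mat_vec_le[OF norms inv(2) c])
  also have "\<dots> \<le> S * \<nu> n (\<Gamma> N *\<^sub>v x)"
    by (rule mult_right_mono[OF \<Gamma>_bound[OF N] vnorm_nonneg[OF norms c]])
  finally show ?thesis .
qed

lemma exp_tendsto_0: "(\<lambda>k. exp (- \<gamma> * real k)) \<longlonglongrightarrow> 0"
proof -
  have "(\<lambda>k. exp (- \<gamma>) ^ k) \<longlonglongrightarrow> 0"
    using \<gamma> by (intro LIMSEQ_realpow_zero) auto
  then show ?thesis by (simp add: exp_of_nat_mult[symmetric] mult.commute)
qed

text \<open>
  As \<open>N\<close> grows, the term \<open>B\<^sub>T V\<^sub>s D\<^sub>s\<^sup>N a\<close> of \<open>\<Gamma> N (a, 0)\<close> vanishes, so the bound on the inverses controls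
  the normalisation of the basis \<open>V\<^sub>s\<close>, on which the Green constant must not depend.
\<close>

lemma stable_lower_bound:
  assumes a: "a \<in> carrier_vec r"
  shows "\<nu> r a \<le> \<kappa> * S * \<beta>\<^sub>0 * \<nu> n (Vs *\<^sub>v a)"
proof -
  let ?R = "\<lambda>N. \<kappa> * (S * (\<beta>\<^sub>0 * \<nu> n (Vs *\<^sub>v a) + \<beta>\<^sub>T * (K * exp (- \<gamma> * real N) * \<nu> r a)))"
  have "\<nu> r a \<le> ?R N" if N: "N \<ge> T0" for N
  proof -
    have ac: "a @\<^sub>v 0\<^sub>v s \<in> carrier_vec n" using a rs by auto
    have "W ^\<^sub>m N *\<^sub>v 0\<^sub>v s = 0\<^sub>v s" "Vu *\<^sub>v 0\<^sub>v s = 0\<^sub>v n"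
      using W_pow Vu by simp_all
    then have "\<Gamma> N *\<^sub>v (a @\<^sub>v 0\<^sub>v s) = B\<^sub>0 *\<^sub>v (Vs *\<^sub>v a) + B\<^sub>T *\<^sub>v (Vs *\<^sub>v (Ds ^\<^sub>m N *\<^sub>v a))"
      using \<Gamma>_mult_vec[OF a, of "0\<^sub>v s" N] a by simp
    then have "\<nu> n (\<Gamma> N *\<^sub>v (a @\<^sub>v 0\<^sub>v s)) \<le> \<nu> n (B\<^sub>0 *\<^sub>v (Vs *\<^sub>v a)) + \<nu> n (B\<^sub>T *\<^sub>v (Vs *\<^sub>v (Ds ^\<^sub>m N *\<^sub>v a)))"
      using vnorm_add[OF norms, of "B\<^sub>0 *\<^sub>v (Vs *\<^sub>v a)" n "B\<^sub>T *\<^sub>v (Vs *\<^sub>v (Ds ^\<^sub>m N *\<^sub>v a))"] a by simp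
    also have "\<dots> \<le> \<beta>\<^sub>0 * \<nu> n (Vs *\<^sub>v a) + \<beta>\<^sub>T * \<nu> n (Vs *\<^sub>v (Ds ^\<^sub>m N *\<^sub>v a))"
      using a by (intro add_mono vnorm_mult_mat_vec_le[OF norms B0] vnorm_mult_mat_vec_le[OF norms BT]) auto
    also have "\<dots> \<le> \<beta>\<^sub>0 * \<nu> n (Vs *\<^sub>v a) + \<beta>\<^sub>T * (K * exp (- \<gamma> * real N) * \<nu> r a)"
      using stable_decay[OF a] op_norm_nonneg[OF norms] by (intro add_left_mono mult_left_mono)
    finally have "S * \<nu> n (\<Gamma> N *\<^sub>v (a @\<^sub>v 0\<^sub>v s)) \<le> S * \<dots>"
      using S_nonneg by (rule mult_left_mono)
    with vnorm_le_\<Gamma>[OF N ac] have "\<nu> n (a @\<^sub>v 0\<^sub>v s) \<le> S * (\<beta>\<^sub>0 * \<nu> n (Vs *\<^sub>v a) + \<beta>\<^sub>T * (K * exp (- \<gamma> * real N) * \<nu> r a))"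
      by (rule order_trans)
    then have "\<kappa> * \<nu> n (a @\<^sub>v 0\<^sub>v s) \<le> ?R N"
      using \<kappa> by (rule mult_left_mono)
    with split_le(1)[OF a zero_carrier_vec] show ?thesis by (rule order_trans)
  qed
  moreover have "?R \<longlonglongrightarrow> \<kappa> * (S * (\<beta>\<^sub>0 * \<nu> n (Vs *\<^sub>v a) + \<beta>\<^sub>T * (K * 0 * \<nu> r a)))"
    by (intro tendsto_intros exp_tendsto_0)
  ultimately have "\<nu> r a \<le> \<kappa> * (S * (\<beta>\<^sub>0 * \<nu> n (Vs *\<^sub>v a) + \<beta>\<^sub>T * (K * 0 * \<nu> r a)))"
    by (intro LIMSEQ_le_const) auto
  then show ?thesis by (simp add: mult_ac)
qed

text \<open>Mirror image of the stable case: for large \<open>N\<close> the term with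
  \<open>W ^\<^sub>m N\<close> at time 0 vanishes, so only the terminal matrix remains.\<close>

lemma unstable_lower_bound:
  assumes c: "c \<in> carrier_vec s"
  shows "\<nu> s c \<le> \<kappa> * S * \<beta>\<^sub>T * \<nu> n (Vu *\<^sub>v c)"
proof -
  let ?R = "\<lambda>N. \<kappa> * (S * (\<beta>\<^sub>0 * (K * exp (- \<gamma> * real N) * \<nu> s c) + \<beta>\<^sub>T * \<nu> n (Vu *\<^sub>v c)))"
  have "\<nu> s c \<le> ?R N" if N: "N \<ge> T0" for N
  proof -
    have ac: "0\<^sub>v r @\<^sub>v c \<in> carrier_vec n" using c rs by auto
    have "Ds ^\<^sub>m N *\<^sub>v 0\<^sub>v r = 0\<^sub>v r" "Vs *\<^sub>v 0\<^sub>v r = 0\<^sub>v n"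
      using Ds_pow Vs by simp_all
    then have "\<Gamma> N *\<^sub>v (0\<^sub>v r @\<^sub>v c) = B\<^sub>0 *\<^sub>v (Vu *\<^sub>v (W ^\<^sub>m N *\<^sub>v c)) + B\<^sub>T *\<^sub>v (Vu *\<^sub>v c)"
      using \<Gamma>_mult_vec[OF _ c, of "0\<^sub>v r" N] c by simp
    then have "\<nu> n (\<Gamma> N *\<^sub>v (0\<^sub>v r @\<^sub>v c)) \<le> \<nu> n (B\<^sub>0 *\<^sub>v (Vu *\<^sub>v (W ^\<^sub>m N *\<^sub>v c))) + \<nu> n (B\<^sub>T *\<^sub>v (Vu *\<^sub>v c))"
      using vnorm_add[OF norms, of "B\<^sub>0 *\<^sub>v (Vu *\<^sub>v (W ^\<^sub>m N *\<^sub>v c))" n "B\<^sub>T *\<^sub>v (Vu *\<^sub>v c)"] c by simp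
    also have "\<dots> \<le> \<beta>\<^sub>0 * \<nu> n (Vu *\<^sub>v (W ^\<^sub>m N *\<^sub>v c)) + \<beta>\<^sub>T * \<nu> n (Vu *\<^sub>v c)"
      using c by (intro add_mono vnorm_mult_mat_vec_le[OF norms B0] vnorm_mult_mat_vec_le[OF norms BT]) auto
    also have "\<dots> \<le> \<beta>\<^sub>0 * (K * exp (- \<gamma> * real N) * \<nu> s c) + \<beta>\<^sub>T * \<nu> n (Vu *\<^sub>v c)"
      using unstable_decay[OF c] op_norm_nonneg[OF norms] by (intro add_right_mono mult_left_mono)
    finally have "S * \<nu> n (\<Gamma> N *\<^sub>v (0\<^sub>v r @\<^sub>v c)) \<le> S * \<dots>"
      using S_nonneg by (rule mult_left_mono)
    with vnorm_le_\<Gamma>[OF N ac] have "\<nu> n (0\<^sub>v r @\<^sub>v c) \<le> S * (\<beta>\<^sub>0 * (K * exp (- \<gamma> * real N) * \<nu> s c) + \<beta>\<^sub>T * \<nu> n (Vu *\<^sub>v c))"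
      by (rule order_trans)
    then have "\<kappa> * \<nu> n (0\<^sub>v r @\<^sub>v c) \<le> ?R N"
      using \<kappa> by (rule mult_left_mono)
    with split_le(2)[OF zero_carrier_vec c] show ?thesis by (rule order_trans)
  qed
  moreover have "?R \<longlonglongrightarrow> \<kappa> * (S * (\<beta>\<^sub>0 * (K * 0 * \<nu> s c) + \<beta>\<^sub>T * \<nu> n (Vu *\<^sub>v c)))"
    by (intro tendsto_intros exp_tendsto_0)
  ultimately have "\<nu> s c \<le> \<kappa> * (S * (\<beta>\<^sub>0 * (K * 0 * \<nu> s c) + \<beta>\<^sub>T * \<nu> n (Vu *\<^sub>v c)))"
    by (intro LIMSEQ_le_const) auto
  then show ?thesis by (simp add: mult_ac)
qed

section \<open>Invariance and complementarity of the two subspaces\<close>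

lemma M_Vs: "a \<in> carrier_vec r \<Longrightarrow> M *\<^sub>v (Vs *\<^sub>v a) = Vs *\<^sub>v (Ds *\<^sub>v a)"
  using assoc_mult_mat_vec[OF M Vs] assoc_mult_mat_vec[OF Vs Ds] MVs by metis

lemma M_Vu: "c \<in> carrier_vec s \<Longrightarrow> M *\<^sub>v (Vu *\<^sub>v c) = Vu *\<^sub>v (Du *\<^sub>v c)"
  using assoc_mult_mat_vec[OF M Vu] assoc_mult_mat_vec[OF Vu Du] MVu by metis

lemma Du_W: "c \<in> carrier_vec s \<Longrightarrow> Du *\<^sub>v (W *\<^sub>v c) = c"
  and W_Du: "c \<in> carrier_vec s \<Longrightarrow> W *\<^sub>v (Du *\<^sub>v c) = c"
  using assoc_mult_mat_vec[OF Du W] assoc_mult_mat_vec[OF W Du] invertible_matE[OF Du_inv Du] one_mult_mat_vec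
  by metis+

lemma Du_pow: "Du ^\<^sub>m k \<in> carrier_mat s s"
  using Du by simp

lemma W_pow_Du_pow: "c \<in> carrier_vec s \<Longrightarrow> W ^\<^sub>m k *\<^sub>v (Du ^\<^sub>m k *\<^sub>v c) = c"
proof (induction k)
  case 0
  then show ?case using W Du by simp
next
  case (Suc k)
  have c: "Du ^\<^sub>m k *\<^sub>v c \<in> carrier_vec s"
    by (rule mult_mat_vec_carrier[OF Du_pow Suc.prems])
  show ?case
    unfolding pow_mat_mult_vec_Suc(2)[OF Du Suc.prems] pow_mat_mult_vec_Suc(1)[OF W mult_carrier(5)[OF c]]
      W_Du[OF c] by (rule Suc.IH[OF Suc.prems])
qed

text \<open>
  A vector in both subspaces equals \<open>D\<^sub>u\<^sup>-\<^sup>k\<close> applied to its \<open>k\<close>-th iterate, and both factors decay.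
\<close>

lemma split_inj:
  assumes a: "a \<in> carrier_vec r" and c: "c \<in> carrier_vec s" and eq: "Vs *\<^sub>v a + Vu *\<^sub>v c = 0\<^sub>v n"
  shows "a = 0\<^sub>v r" "c = 0\<^sub>v s"
proof -
  let ?L = "\<kappa> * S * \<beta>\<^sub>T"
  have L: "0 \<le> ?L"
    using \<kappa> S_nonneg op_norm_nonneg[OF norms] by simp
  have iter: "Vs *\<^sub>v (Ds ^\<^sub>m k *\<^sub>v a) + Vu *\<^sub>v (Du ^\<^sub>m k *\<^sub>v c) = 0\<^sub>v n" for k
  proof (induction k)
    case 0
    show ?case using eq a c Ds Du by simp
  next
    case (Suc k)
    have ck: "Ds ^\<^sub>m k *\<^sub>v a \<in> carrier_vec r" "Du ^\<^sub>m k *\<^sub>v c \<in> carrier_vec s"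
      using mult_mat_vec_carrier[OF Du_pow c] a by auto
    have "Vs *\<^sub>v (Ds ^\<^sub>m Suc k *\<^sub>v a) + Vu *\<^sub>v (Du ^\<^sub>m Suc k *\<^sub>v c) =
        M *\<^sub>v (Vs *\<^sub>v (Ds ^\<^sub>m k *\<^sub>v a)) + M *\<^sub>v (Vu *\<^sub>v (Du ^\<^sub>m k *\<^sub>v c))"
      by (simp only: pow_mat_mult_vec_Suc(2)[OF Ds a] pow_mat_mult_vec_Suc(2)[OF Du c] M_Vs[OF ck(1)] M_Vu[OF ck(2)])
    also have "\<dots> = M *\<^sub>v (Vs *\<^sub>v (Ds ^\<^sub>m k *\<^sub>v a) + Vu *\<^sub>v (Du ^\<^sub>m k *\<^sub>v c))"
      using ck by (intro mult_add_distrib_mat_vec[OF M, symmetric]) auto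
    finally show ?case using M by (simp add: Suc)
  qed
  have "\<nu> n (Vu *\<^sub>v c) \<le> (K * exp (- \<gamma> * real k)) * (?L * ((K * exp (- \<gamma> * real k)) * \<nu> r a))" for k
  proof -
    have ck: "Ds ^\<^sub>m k *\<^sub>v a \<in> carrier_vec r" "Du ^\<^sub>m k *\<^sub>v c \<in> carrier_vec s"
      using mult_mat_vec_carrier[OF Du_pow c] a by auto
    have "Vu *\<^sub>v (Du ^\<^sub>m k *\<^sub>v c) = - (Vs *\<^sub>v (Ds ^\<^sub>m k *\<^sub>v a))"
    proof -
      have "y = - x" if "x + y = 0\<^sub>v n" "x \<in> carrier_vec n" "y \<in> carrier_vec n" for x y :: "real vec"
      proof (rule eq_vecI)
        fix i assume "i < dim_vec (- x)"
        then show "y $ i = (- x) $ i"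
          using arg_cong[OF that(1), of "\<lambda>u. u $ i"] that(2,3) by simp
      qed (use that in auto)
      then show ?thesis using iter ck by simp
    qed
    then have "\<nu> n (Vu *\<^sub>v (Du ^\<^sub>m k *\<^sub>v c)) = \<nu> n (Vs *\<^sub>v (Ds ^\<^sub>m k *\<^sub>v a))"
      using vnorm_uminus[OF norms] ck by simp
    with stable_decay[OF a] have "\<nu> n (Vu *\<^sub>v (Du ^\<^sub>m k *\<^sub>v c)) \<le> K * exp (- \<gamma> * real k) * \<nu> r a"
      by simp
    then have "?L * \<nu> n (Vu *\<^sub>v (Du ^\<^sub>m k *\<^sub>v c)) \<le> ?L * (K * exp (- \<gamma> * real k) * \<nu> r a)"
      using L by (rule mult_left_mono)
    \<comment> \<open>The lower bound is used for the iterate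
      \<open>Du ^\<^sub>m k *\<^sub>v c\<close>, whose image under \<open>Vu\<close> is small
      because it cancels a decaying stable vector.\<close>
    with unstable_lower_bound[OF ck(2)] have "\<nu> s (Du ^\<^sub>m k *\<^sub>v c) \<le> ?L * (K * exp (- \<gamma> * real k) * \<nu> r a)"
      by (rule order_trans)
    then have "K * exp (- \<gamma> * real k) * \<nu> s (Du ^\<^sub>m k *\<^sub>v c) \<le> K * exp (- \<gamma> * real k) * (?L * (K * exp (- \<gamma> * real k) * \<nu> r a))"
      using K by (intro mult_left_mono) auto
    with unstable_decay[OF ck(2), of k] show ?thesis
      unfolding W_pow_Du_pow[OF c] by (rule order_trans)
  qed
  moreover have "(\<lambda>k. (K * exp (- \<gamma> * real k)) * (?L * ((K * exp (- \<gamma> * real k)) * \<nu> r a))) \<longlonglongrightarrow> (K * 0) * (?L * ((K * 0) * \<nu> r a))"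
    by (intro tendsto_intros exp_tendsto_0)
  ultimately have "\<nu> n (Vu *\<^sub>v c) \<le> (K * 0) * (?L * ((K * 0) * \<nu> r a))"
    by (intro LIMSEQ_le_const) auto
  then have "\<nu> n (Vu *\<^sub>v c) = 0"
    using vnorm_nonneg[OF norms mult_carrier(3)[OF c]] by simp
  then have Vuc: "Vu *\<^sub>v c = 0\<^sub>v n"
    using vnorm_eq_0_iff[OF norms mult_carrier(3)[OF c]] by simp
  \<comment> \<open>Independence of the columns is obtained from the lower bounds: a coordinate
    vector with image 0 has norm 0.\<close>
  have "\<nu> s c = 0"
    using unstable_lower_bound[OF c] vnorm_nonneg[OF norms c] vnorm_zero[OF norms] unfolding Vuc by simp
  then show "c = 0\<^sub>v s"
    using vnorm_eq_0_iff[OF norms c] by simp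
  have Vsa: "Vs *\<^sub>v a = 0\<^sub>v n"
    using eq a unfolding Vuc by simp
  have "\<nu> r a = 0"
    using stable_lower_bound[OF a] vnorm_nonneg[OF norms a] vnorm_zero[OF norms] unfolding Vsa by simp
  then show "a = 0\<^sub>v r"
    using vnorm_eq_0_iff[OF norms a] by simp
qed

lemma split_carrier: "append_columns Vs Vu \<in> carrier_mat n n"
  using append_columns_carrier[OF Vs Vu] by (simp add: rs)

lemma split_invertible: "invertible_mat (append_columns Vs Vu)"
  using split_inj by (intro append_columns_invertible[OF Vs Vu rs]) blast

lemma split_surj:
  assumes x: "x \<in> carrier_vec n"
  shows "\<exists>a \<in> carrier_vec r. \<exists>c \<in> carrier_vec s. x = Vs *\<^sub>v a + Vu *\<^sub>v c"
proof -
  note inv = invertible_matE[OF split_invertible split_carrier]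
  define y where "y = mat_inv (append_columns Vs Vu) *\<^sub>v x"
  have y: "y \<in> carrier_vec (r + s)"
    unfolding y_def rs by (rule mult_mat_vec_carrier[OF inv(2) x])
  have "x = append_columns Vs Vu *\<^sub>v y"
    using assoc_mult_mat_vec[OF split_carrier inv(2) x] unfolding y_def inv(3) one_mult_mat_vec[OF x] .
  also have "\<dots> = Vs *\<^sub>v vec_first y r + Vu *\<^sub>v vec_last y s"
    using append_columns_mult_vec[OF Vs Vu vec_first_carrier vec_last_carrier, of y y]
    unfolding vec_first_last_append[OF y] .
  finally show ?thesis
    using vec_first_carrier vec_last_carrier by blast
qed

end

lemma minus_eq_0_vecD:
  fixes x y :: "'a :: group_add vec"
  assumes "x - y = 0\<^sub>v n" "x \<in> carrier_vec n" "y \<in> carrier_vec n"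
  shows "x = y"
proof (rule eq_vecI)
  fix i assume "i < dim_vec y"
  then show "x $ i = y $ i"
    using arg_cong[OF assms(1), of "\<lambda>u. u $ i"] assms(2,3) by simp
qed (use assms in auto)

lemma minus_eq_minus_vec_swap:
  fixes x y :: "'a :: ab_group_add vec"
  assumes eq: "x - y = x' - y'" and c: "x \<in> carrier_vec n" "x' \<in> carrier_vec n" "y \<in> carrier_vec n" "y' \<in> carrier_vec n"
  shows "x - x' = y - y'"
proof (rule eq_vecI)
  fix i assume "i < dim_vec (y - y')"
  then show "(x - x') $ i = (y - y') $ i"
    using arg_cong[OF eq, of "\<lambda>u. u $ i"] c by (simp add: algebra_simps)
qed (use c in auto)

lemma linear_pair_map_diff_mult:
  assumes M: "M \<in> carrier_mat n n"
  shows "linear_pair_map n (\<lambda>h h'. h' - M *\<^sub>v h)"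
  unfolding linear_pair_map_def
proof (intro conjI ballI allI)
  fix x y x' y' :: "real vec" and c :: real
  assume x: "x \<in> carrier_vec n" and y: "y \<in> carrier_vec n"
  then have Mx: "M *\<^sub>v x \<in> carrier_vec n" using M by simp
  then show "y - M *\<^sub>v x \<in> carrier_vec n" using y by simp
  show "c \<cdot>\<^sub>v y - M *\<^sub>v (c \<cdot>\<^sub>v x) = c \<cdot>\<^sub>v (y - M *\<^sub>v x)"
    unfolding mult_mat_vec[OF M x] using M y Mx by (intro eq_vecI) (auto simp: algebra_simps)
  assume x': "x' \<in> carrier_vec n" and y': "y' \<in> carrier_vec n"
  then have Mx': "M *\<^sub>v x' \<in> carrier_vec n" using M by simp
  show "y + y' - M *\<^sub>v (x + x') = y - M *\<^sub>v x + (y' - M *\<^sub>v x')"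
    unfolding mult_add_distrib_mat_vec[OF M x x'] using M y y' Mx Mx' by (intro eq_vecI) auto
qed

section \<open>Coordinate bounds through the projectors, and the homogeneous problem\<close>

context dichotomous_bvp
begin

abbreviation "E\<^sub>s \<equiv> {Vs *\<^sub>v a | a. a \<in> carrier_vec r}"
abbreviation "E\<^sub>u \<equiv> {Vu *\<^sub>v c | c. c \<in> carrier_vec s}"

definition "L\<^sub>s = \<kappa> * S * \<beta>\<^sub>0 * op_norm \<nu> (projector n E\<^sub>s E\<^sub>u)"
definition "L\<^sub>u = \<kappa> * S * \<beta>\<^sub>T * op_norm \<nu> (projector n E\<^sub>u E\<^sub>s)"

lemma L_nonneg: "0 \<le> L\<^sub>s" "0 \<le> L\<^sub>u"
  using \<kappa> S_nonneg op_norm_nonneg[OF norms] by (simp_all add: L\<^sub>s_def L\<^sub>u_def)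

text \<open>The projector norm bounds the stable component by the whole vector, and the lower bound
  then passes from the component to its coordinate. The product of the two constants is
  \<open>L\<^sub>s\<close>.\<close>

lemma stable_coord_le:
  assumes a: "a \<in> carrier_vec r" and c: "c \<in> carrier_vec s"
  shows "\<nu> r a \<le> L\<^sub>s * \<nu> n (Vs *\<^sub>v a + Vu *\<^sub>v c)"
proof -
  note P = projector_eq[OF Vs Vu rs split_invertible refl refl]
  have x: "Vs *\<^sub>v a + Vu *\<^sub>v c \<in> carrier_vec n" using a c by simp
  have "\<nu> n (Vs *\<^sub>v a) \<le> op_norm \<nu> (projector n E\<^sub>s E\<^sub>u) * \<nu> n (Vs *\<^sub>v a + Vu *\<^sub>v c)"
    using vnorm_mult_mat_vec_le[OF norms P(1) x] unfolding P(2)[OF a c] .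
  then have "\<kappa> * S * \<beta>\<^sub>0 * \<nu> n (Vs *\<^sub>v a) \<le> L\<^sub>s * \<nu> n (Vs *\<^sub>v a + Vu *\<^sub>v c)"
    using \<kappa> S_nonneg op_norm_nonneg[OF norms] unfolding L\<^sub>s_def
    by (simp add: mult.assoc mult_left_mono)
  with stable_lower_bound[OF a] show ?thesis by (rule order_trans)
qed

lemma unstable_coord_le:
  assumes a: "a \<in> carrier_vec r" and c: "c \<in> carrier_vec s"
  shows "\<nu> s c \<le> L\<^sub>u * \<nu> n (Vs *\<^sub>v a + Vu *\<^sub>v c)"
proof -
  have sr: "s + r = n" using rs by simp
  have comm: "Vu *\<^sub>v c + Vs *\<^sub>v a = Vs *\<^sub>v a + Vu *\<^sub>v c" if "a \<in> carrier_vec r" "c \<in> carrier_vec s" for a c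
    using that by (intro comm_add_vec[of _ n]) simp_all
  \<comment> \<open>The projector lemma extracts the component of the first block, so the blocks are
    exchanged.\<close>
  have "invertible_mat (append_columns Vu Vs)"
    using split_inj comm by (intro append_columns_invertible[OF Vu Vs sr]) auto
  note P = projector_eq[OF Vu Vs sr this refl refl]
  have x: "Vs *\<^sub>v a + Vu *\<^sub>v c \<in> carrier_vec n" using a c by simp
  have "\<nu> n (Vu *\<^sub>v c) \<le> op_norm \<nu> (projector n E\<^sub>u E\<^sub>s) * \<nu> n (Vs *\<^sub>v a + Vu *\<^sub>v c)"
    using vnorm_mult_mat_vec_le[OF norms P(1) x] P(2)[OF c a] unfolding comm[OF a c] by simp
  then have "\<kappa> * S * \<beta>\<^sub>T * \<nu> n (Vu *\<^sub>v c) \<le> L\<^sub>u * \<nu> n (Vs *\<^sub>v a + Vu *\<^sub>v c)"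
    using \<kappa> S_nonneg op_norm_nonneg[OF norms] unfolding L\<^sub>u_def
    by (simp add: mult.assoc mult_left_mono)
  with unstable_lower_bound[OF c] show ?thesis by (rule order_trans)
qed

text \<open>With the unstable coordinate taken at the terminal time,
  \<open>Du ^\<^sub>m T *\<^sub>v c\<close>, the boundary condition says that
  \<open>\<Gamma> T\<close> annihilates the coordinates; both end values vanish, and with them the
  whole orbit.\<close>

lemma homogeneous_bvp:
  assumes T: "T0 \<le> T" and d: "\<And>t. t \<le> T \<Longrightarrow> d t \<in> carrier_vec n"
    and step: "\<And>t. t < T \<Longrightarrow> d (Suc t) = M *\<^sub>v d t"
    and boundary: "B\<^sub>0 *\<^sub>v d 0 + B\<^sub>T *\<^sub>v d T = 0\<^sub>v n" and t: "t \<le> T"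
  shows "d t = 0\<^sub>v n"
proof -
  obtain a c where a: "a \<in> carrier_vec r" and c: "c \<in> carrier_vec s" and d0: "d 0 = Vs *\<^sub>v a + Vu *\<^sub>v c"
    using split_surj[OF d[of 0]] by auto
  have Duc: "Du ^\<^sub>m t *\<^sub>v c \<in> carrier_vec s" for t
    by (rule mult_mat_vec_carrier[OF Du_pow c])
  have dt: "t \<le> T \<Longrightarrow> d t = Vs *\<^sub>v (Ds ^\<^sub>m t *\<^sub>v a) + Vu *\<^sub>v (Du ^\<^sub>m t *\<^sub>v c)" for t
  proof (induction t)
    case 0
    show ?case using d0 a c Ds Du by simp
  next
    case (Suc t)
    have "d (Suc t) = M *\<^sub>v (Vs *\<^sub>v (Ds ^\<^sub>m t *\<^sub>v a) + Vu *\<^sub>v (Du ^\<^sub>m t *\<^sub>v c))"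
      using Suc step[of t] by simp
    also have "\<dots> = M *\<^sub>v (Vs *\<^sub>v (Ds ^\<^sub>m t *\<^sub>v a)) + M *\<^sub>v (Vu *\<^sub>v (Du ^\<^sub>m t *\<^sub>v c))"
      using a Duc by (intro mult_add_distrib_mat_vec[OF M]) simp_all
    also have "\<dots> = Vs *\<^sub>v (Ds ^\<^sub>m Suc t *\<^sub>v a) + Vu *\<^sub>v (Du ^\<^sub>m Suc t *\<^sub>v c)"
      unfolding pow_mat_mult_vec_Suc(2)[OF Ds a] pow_mat_mult_vec_Suc(2)[OF Du c]
        M_Vs[OF mult_carrier(9)[OF a]] M_Vu[OF Duc] ..
    finally show ?case .
  qed
  have x: "a @\<^sub>v Du ^\<^sub>m T *\<^sub>v c \<in> carrier_vec n"
    using append_carrier_vec[OF a Duc] by (simp add: rs)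
  have "\<Gamma> T *\<^sub>v (a @\<^sub>v Du ^\<^sub>m T *\<^sub>v c) = 0\<^sub>v n"
    unfolding \<Gamma>_mult_vec[OF a Duc] W_pow_Du_pow[OF c] using boundary d0 dt[of T] by simp
  with vnorm_le_\<Gamma>[OF T x] have "\<nu> n (a @\<^sub>v Du ^\<^sub>m T *\<^sub>v c) = 0"
    using vnorm_nonneg[OF norms x] by (simp add: vnorm_zero[OF norms])
  then have "\<nu> r a \<le> 0" "\<nu> s (Du ^\<^sub>m T *\<^sub>v c) \<le> 0"
    using split_le[OF a Duc, of T] by simp_all
  then have "a = 0\<^sub>v r" "Du ^\<^sub>m T *\<^sub>v c = 0\<^sub>v s"
    using vnorm_nonneg[OF norms a] vnorm_eq_0_iff[OF norms a]
      vnorm_nonneg[OF norms Duc[of T]] vnorm_eq_0_iff[OF norms Duc[of T]] by (auto simp: order_antisym)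
  moreover from this have "c = 0\<^sub>v s"
    using W_pow_Du_pow[OF c, of T] mult_mat_zero_vec[OF W_pow, of T] by simp
  ultimately show ?thesis
    using dt[OF t] Vs Vu mult_mat_zero_vec[OF Ds_pow, of t] mult_mat_zero_vec[OF Du_pow, of t] by simp
qed

section \<open>Forward and backward solution of the decoupled recursion\<close>

text \<open>Solving \<open>c_{t+1} = Du c_t + \<psi>_t\<close> for \<open>c_t\<close> gives
  \<open>c_t = W c_{t+1} + W (- \<psi>_t)\<close>. In the reversed time
  \<open>j = T - (t + 1)\<close> the forcing index is \<open>t = T - Suc j\<close>.\<close>

definition unstable_forcing :: "(nat \<Rightarrow> real vec) \<Rightarrow> nat \<Rightarrow> nat \<Rightarrow> real vec" where
  "unstable_forcing \<psi> T j = W *\<^sub>v (- \<psi> (T - Suc j))"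

text \<open>The free data sit at opposite ends: \<open>a\<close> at time 0, \<open>c\<close> at time
  \<open>T\<close>. Only \<open>t \<le> T\<close> is meant, where the subtraction does not
  truncate.\<close>

definition bvp_orbit ::
  "(nat \<Rightarrow> real vec) \<Rightarrow> (nat \<Rightarrow> real vec) \<Rightarrow> nat \<Rightarrow> real vec \<Rightarrow> real vec \<Rightarrow> nat \<Rightarrow> real vec" where
  "bvp_orbit \<phi> \<psi> T a c t =
    Vs *\<^sub>v affine_orbit Ds \<phi> a t + Vu *\<^sub>v affine_orbit W (unstable_forcing \<psi> T) c (T - t)"

lemma unstable_forcing_carrier:
  "(\<And>t. \<psi> t \<in> carrier_vec s) \<Longrightarrow> unstable_forcing \<psi> T j \<in> carrier_vec s"
  unfolding unstable_forcing_def by simp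

context
  fixes \<phi> :: "nat \<Rightarrow> real vec" and a :: "real vec"
  assumes \<phi>: "\<And>t. \<phi> t \<in> carrier_vec r" and a: "a \<in> carrier_vec r"
begin

lemma stable_orbit_carrier: "affine_orbit Ds \<phi> a t \<in> carrier_vec r"
  using Ds a \<phi> by (rule affine_orbit_carrier)

text \<open>\<open>F\<close> stands for the norms of the right-hand side, of which
  \<open>\<phi>\<close> are the stable coordinates. The factor \<open>exp \<gamma>\<close> converts
  the exponent \<open>t - 1 - j\<close> of the orbit bound into the \<open>t - j\<close> of the
  kernel.\<close>

lemma stable_orbit_bound:
  assumes F: "\<And>t. t < T \<Longrightarrow> \<nu> r (\<phi> t) \<le> L\<^sub>s * F t" and F0: "\<And>t. 0 \<le> F t" and t: "t \<le> T"
  shows "\<nu> n (Vs *\<^sub>v affine_orbit Ds \<phi> a t) \<le> K * exp (- \<gamma> * real t) * \<nu> r a +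
    K * exp \<gamma> * L\<^sub>s * (\<Sum>j<T. exp (- \<gamma> * \<bar>real t - real j\<bar>) * F j)"
proof -
  have "\<nu> n (Vs *\<^sub>v (Ds ^\<^sub>m 0 *\<^sub>v affine_orbit Ds \<phi> a t)) \<le>
      K * exp (- \<gamma> * (real 0 + real t)) * \<nu> r (affine_orbit Ds \<phi> a 0) +
      (\<Sum>j<t. exp (- \<gamma> * (real 0 + real t - 1 - real j)) * (K * \<nu> r (\<phi> j)))"
  proof (rule orbit_bound[OF norms Vs Ds])
    show "\<nu> n (Vs *\<^sub>v (Ds ^\<^sub>m k *\<^sub>v \<phi> j)) \<le> exp (- \<gamma> * real k) * (K * \<nu> r (\<phi> j))" for k j
      using stable_decay[OF \<phi>] by (simp add: mult_ac)
  qed (use stable_decay[OF a] in \<open>simp_all add: stable_orbit_carrier \<phi>\<close>)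
  also have "Ds ^\<^sub>m 0 *\<^sub>v affine_orbit Ds \<phi> a t = affine_orbit Ds \<phi> a t"
    using Ds stable_orbit_carrier by simp
  also have "(\<Sum>j<t. exp (- \<gamma> * (real 0 + real t - 1 - real j)) * (K * \<nu> r (\<phi> j))) \<le>
      (\<Sum>j<t. K * exp \<gamma> * L\<^sub>s * (exp (- \<gamma> * \<bar>real t - real j\<bar>) * F j))"
  proof (rule sum_mono)
    fix j assume j: "j \<in> {..<t}"
    have "exp (- \<gamma> * (real 0 + real t - 1 - real j)) = exp \<gamma> * exp (- \<gamma> * \<bar>real t - real j\<bar>)"
      using j by (simp add: exp_add[symmetric] algebra_simps)
    moreover have "K * \<nu> r (\<phi> j) \<le> K * (L\<^sub>s * F j)"
      using F[of j] j t K by (intro mult_left_mono) auto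
    ultimately have "exp (- \<gamma> * (real 0 + real t - 1 - real j)) * (K * \<nu> r (\<phi> j)) \<le>
        exp \<gamma> * exp (- \<gamma> * \<bar>real t - real j\<bar>) * (K * (L\<^sub>s * F j))"
      by (simp only:) (rule mult_left_mono, assumption, simp)
    then show "exp (- \<gamma> * (real 0 + real t - 1 - real j)) * (K * \<nu> r (\<phi> j)) \<le>
        K * exp \<gamma> * L\<^sub>s * (exp (- \<gamma> * \<bar>real t - real j\<bar>) * F j)"
      by (simp only: mult_ac)
  qed
  \<comment> \<open>Future forcing does not act on the stable part; its nonnegative terms are added
    so that both parts are bounded by the same sum.\<close>
  also have "\<dots> \<le> (\<Sum>j<T. K * exp \<gamma> * L\<^sub>s * (exp (- \<gamma> * \<bar>real t - real j\<bar>) * F j))"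
    using t K L_nonneg F0 by (intro sum_mono2) auto
  finally show ?thesis
    by (simp add: sum_distrib_left)
qed

end

context
  fixes \<psi> :: "nat \<Rightarrow> real vec" and c :: "real vec" and T :: nat
  assumes \<psi>: "\<And>t. \<psi> t \<in> carrier_vec s" and c: "c \<in> carrier_vec s"
begin

lemma unstable_orbit_carrier: "affine_orbit W (unstable_forcing \<psi> T) c j \<in> carrier_vec s"
  using W c unstable_forcing_carrier[OF \<psi>] by (rule affine_orbit_carrier)

text \<open>The forcing carries an additional \<open>W\<close>, so its decay starts one power later.
  This gives the weight \<open>K * exp (- \<gamma>)\<close> and, after time reversal, the exponent
  \<open>j - t\<close>.\<close>

lemma unstable_orbit_bound:
  assumes F: "\<And>t. t < T \<Longrightarrow> \<nu> s (\<psi> t) \<le> L\<^sub>u * F t" and F0: "\<And>t. 0 \<le> F t" and t: "t \<le> T"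
  shows "\<nu> n (Vu *\<^sub>v affine_orbit W (unstable_forcing \<psi> T) c (T - t)) \<le>
    K * exp (- \<gamma> * (real T - real t)) * \<nu> s c +
    K * exp \<gamma> * L\<^sub>u * (\<Sum>j<T. exp (- \<gamma> * \<bar>real t - real j\<bar>) * F j)"
proof -
  let ?m = "T - t"
  let ?g = "\<lambda>j. exp (- \<gamma> * (real j - real t)) * (K * exp (- \<gamma>) * \<nu> s (\<psi> j))"
  have "\<nu> n (Vu *\<^sub>v (W ^\<^sub>m 0 *\<^sub>v affine_orbit W (unstable_forcing \<psi> T) c ?m)) \<le>
      K * exp (- \<gamma> * (real 0 + real ?m)) * \<nu> s (affine_orbit W (unstable_forcing \<psi> T) c 0) +
      (\<Sum>j<?m. exp (- \<gamma> * (real 0 + real ?m - 1 - real j)) * (K * exp (- \<gamma>) * \<nu> s (\<psi> (T - Suc j))))"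
  proof (rule orbit_bound[OF norms Vu W])
    show "\<nu> n (Vu *\<^sub>v (W ^\<^sub>m k *\<^sub>v unstable_forcing \<psi> T j)) \<le> exp (- \<gamma> * real k) * (K * exp (- \<gamma>) * \<nu> s (\<psi> (T - Suc j)))" for k j
    proof -
      have m: "- \<psi> (T - Suc j) \<in> carrier_vec s" using \<psi> by simp
      have "W ^\<^sub>m k *\<^sub>v unstable_forcing \<psi> T j = W ^\<^sub>m Suc k *\<^sub>v (- \<psi> (T - Suc j))"
        unfolding unstable_forcing_def pow_mat_mult_vec_Suc(1)[OF W m] ..
      then have "\<nu> n (Vu *\<^sub>v (W ^\<^sub>m k *\<^sub>v unstable_forcing \<psi> T j)) \<le> K * exp (- \<gamma> * real (Suc k)) * \<nu> s (\<psi> (T - Suc j))"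
        using unstable_decay[OF m, of "Suc k"] by (simp only: vnorm_uminus[OF norms \<psi>])
      also have "exp (- \<gamma> * real (Suc k)) = exp (- \<gamma> * real k) * exp (- \<gamma>)"
        by (simp add: exp_add[symmetric] algebra_simps)
      finally show ?thesis by (simp only: mult_ac)
    qed
  qed (use unstable_decay[OF c] in \<open>simp_all add: unstable_orbit_carrier unstable_forcing_carrier[OF \<psi>]\<close>)
  also have "W ^\<^sub>m 0 *\<^sub>v affine_orbit W (unstable_forcing \<psi> T) c ?m = affine_orbit W (unstable_forcing \<psi> T) c ?m"
    using W unstable_orbit_carrier by simp
  \<comment> \<open>Back from reversed time: step \<open>j\<close> belongs to the original index
    \<open>T - Suc j\<close>, and the \<open>T - t\<close> steps cover the indices from
    \<open>t\<close> to \<open>T - 1\<close>.\<close>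
  also have "(\<Sum>j<?m. exp (- \<gamma> * (real 0 + real ?m - 1 - real j)) * (K * exp (- \<gamma>) * \<nu> s (\<psi> (T - Suc j)))) = (\<Sum>j\<in>{t..<T}. ?g j)"
    using t by (intro sum.reindex_bij_witness[of _ "\<lambda>j. T - Suc j" "\<lambda>j. T - Suc j"]) (auto simp: of_nat_diff Suc_diff_Suc algebra_simps)
  also have "\<dots> \<le> (\<Sum>j\<in>{t..<T}. K * exp \<gamma> * L\<^sub>u * (exp (- \<gamma> * \<bar>real t - real j\<bar>) * F j))"
  proof (rule sum_mono)
    fix j assume j: "j \<in> {t..<T}"
    have "exp (- \<gamma> * (real j - real t)) = exp (- \<gamma> * \<bar>real t - real j\<bar>)"
      using j by simp
    \<comment> \<open>\<open>exp (- \<gamma>)\<close> is weakened to \<open>exp \<gamma>\<close>, to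
      give the constant the same form as in the stable bound.\<close>
    moreover have "K * exp (- \<gamma>) * \<nu> s (\<psi> j) \<le> K * exp \<gamma> * (L\<^sub>u * F j)"
      using F[of j] j K \<gamma> vnorm_nonneg[OF norms \<psi>] by (intro mult_mono) auto
    ultimately have "?g j \<le> exp (- \<gamma> * \<bar>real t - real j\<bar>) * (K * exp \<gamma> * (L\<^sub>u * F j))"
      by (simp only:) (rule mult_left_mono, assumption, simp)
    then show "?g j \<le> K * exp \<gamma> * L\<^sub>u * (exp (- \<gamma> * \<bar>real t - real j\<bar>) * F j)"
      by (simp only: mult_ac)
  qed
  also have "\<dots> \<le> (\<Sum>j<T. K * exp \<gamma> * L\<^sub>u * (exp (- \<gamma> * \<bar>real t - real j\<bar>) * F j))"
    using K L_nonneg F0 by (intro sum_mono2) auto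
  finally show ?thesis
    using t by (simp add: sum_distrib_left of_nat_diff)
qed

end

context
  fixes \<phi> \<psi> :: "nat \<Rightarrow> real vec" and a c :: "real vec" and T :: nat
  assumes \<phi>: "\<And>t. \<phi> t \<in> carrier_vec r" and \<psi>: "\<And>t. \<psi> t \<in> carrier_vec s"
    and a: "a \<in> carrier_vec r" and c: "c \<in> carrier_vec s"
begin

lemma bvp_orbit_carrier: "bvp_orbit \<phi> \<psi> T a c t \<in> carrier_vec n"
  using stable_orbit_carrier[OF \<phi> a] unstable_orbit_carrier[OF \<psi> c] unfolding bvp_orbit_def by simp

text \<open>On the unstable part \<open>M\<close> acts as \<open>Du\<close>, which cancels the
  \<open>W\<close> of the backward step and returns the value at \<open>Suc t\<close> minus the
  forcing.\<close>

lemma bvp_orbit_step: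
  assumes t: "t < T"
  shows "bvp_orbit \<phi> \<psi> T a c (Suc t) - M *\<^sub>v bvp_orbit \<phi> \<psi> T a c t = Vs *\<^sub>v \<phi> t + Vu *\<^sub>v \<psi> t"
proof -
  define x where "x = affine_orbit Ds \<phi> a t"
  define y where "y = affine_orbit W (unstable_forcing \<psi> T) c (T - Suc t)"
  have x: "x \<in> carrier_vec r" and y: "y \<in> carrier_vec s"
    unfolding x_def y_def by (rule stable_orbit_carrier[OF \<phi> a] unstable_orbit_carrier[OF \<psi> c])+
  have "T - t = Suc (T - Suc t)" "T - Suc (T - Suc t) = t" using t by simp_all
  then have "affine_orbit W (unstable_forcing \<psi> T) c (T - t) = W *\<^sub>v y + W *\<^sub>v (- \<psi> t)"
    by (simp add: y_def unstable_forcing_def)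
  also have "\<dots> = W *\<^sub>v (y + - \<psi> t)"
    using \<psi> by (intro mult_add_distrib_mat_vec[OF W y, symmetric]) simp
  finally have orbit: "bvp_orbit \<phi> \<psi> T a c t = Vs *\<^sub>v x + Vu *\<^sub>v (W *\<^sub>v (y + - \<psi> t))"
    by (simp add: bvp_orbit_def x_def)
  have y\<psi>: "y + - \<psi> t \<in> carrier_vec s" using y \<psi> by simp
  have "M *\<^sub>v bvp_orbit \<phi> \<psi> T a c t = M *\<^sub>v (Vs *\<^sub>v x) + M *\<^sub>v (Vu *\<^sub>v (W *\<^sub>v (y + - \<psi> t)))"
    unfolding orbit using x y\<psi> by (intro mult_add_distrib_mat_vec[OF M]) simp_all
  also have "\<dots> = Vs *\<^sub>v (Ds *\<^sub>v x) + Vu *\<^sub>v (y + - \<psi> t)"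
    unfolding M_Vs[OF x] M_Vu[OF mult_carrier(6)[OF y\<psi>]] Du_W[OF y\<psi>] ..
  also have "Vu *\<^sub>v (y + - \<psi> t) = Vu *\<^sub>v y + - (Vu *\<^sub>v \<psi> t)"
  proof -
    have "Vu *\<^sub>v (- \<psi> t) = - (Vu *\<^sub>v \<psi> t)"
      using \<psi>[of t] Vu by (intro eq_vecI) auto
    then show ?thesis
      using mult_add_distrib_mat_vec[OF Vu y, of "- \<psi> t"] \<psi>[of t] by simp
  qed
  finally have M_orbit: "M *\<^sub>v bvp_orbit \<phi> \<psi> T a c t = Vs *\<^sub>v (Ds *\<^sub>v x) + (Vu *\<^sub>v y + - (Vu *\<^sub>v \<psi> t))" .
  have "bvp_orbit \<phi> \<psi> T a c (Suc t) = Vs *\<^sub>v (Ds *\<^sub>v x + \<phi> t) + Vu *\<^sub>v y"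
    by (simp add: bvp_orbit_def x_def y_def)
  also have "Vs *\<^sub>v (Ds *\<^sub>v x + \<phi> t) = Vs *\<^sub>v (Ds *\<^sub>v x) + Vs *\<^sub>v \<phi> t"
    using x \<phi> by (intro mult_add_distrib_mat_vec[OF Vs]) simp_all
  finally show ?thesis
    unfolding M_orbit using mult_carrier(2)[OF mult_carrier(4)[OF x]] mult_carrier(2)[OF \<phi>[of t]]
      mult_carrier(3)[OF y] mult_carrier(3)[OF \<psi>[of t]]
    by (intro eq_vecI) auto
qed

text \<open>With zero end values, only the backward unstable part is nonzero at time 0 and only the
  forward stable part at time \<open>T\<close>; these two make up the last summand.\<close>

lemma bvp_orbit_boundary:
  "B\<^sub>0 *\<^sub>v bvp_orbit \<phi> \<psi> T a c 0 + B\<^sub>T *\<^sub>v bvp_orbit \<phi> \<psi> T a c T = \<Gamma> T *\<^sub>v (a @\<^sub>v c) +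
    (B\<^sub>0 *\<^sub>v (Vu *\<^sub>v affine_orbit W (unstable_forcing \<psi> T) (0\<^sub>v s) T) + B\<^sub>T *\<^sub>v (Vs *\<^sub>v affine_orbit Ds \<phi> (0\<^sub>v r) T))"
proof -
  define x where "x = affine_orbit Ds \<phi> (0\<^sub>v r) T"
  define y where "y = affine_orbit W (unstable_forcing \<psi> T) (0\<^sub>v s) T"
  have x: "x \<in> carrier_vec r" and y: "y \<in> carrier_vec s"
    unfolding x_def y_def
    by (rule stable_orbit_carrier[OF \<phi> zero_carrier_vec] unstable_orbit_carrier[OF \<psi> zero_carrier_vec])+
  note [simp] = x y a c
  have "bvp_orbit \<phi> \<psi> T a c 0 = Vs *\<^sub>v a + Vu *\<^sub>v (W ^\<^sub>m T *\<^sub>v c + y)"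
    unfolding bvp_orbit_def y_def using affine_orbit_split[OF W c unstable_forcing_carrier[OF \<psi>], where j = T] by simp
  also have "Vu *\<^sub>v (W ^\<^sub>m T *\<^sub>v c + y) = Vu *\<^sub>v (W ^\<^sub>m T *\<^sub>v c) + Vu *\<^sub>v y"
    by (intro mult_add_distrib_mat_vec[OF Vu]) simp_all
  also have "Vs *\<^sub>v a + (Vu *\<^sub>v (W ^\<^sub>m T *\<^sub>v c) + Vu *\<^sub>v y) = (Vs *\<^sub>v a + Vu *\<^sub>v (W ^\<^sub>m T *\<^sub>v c)) + Vu *\<^sub>v y"
    by (intro assoc_add_vec[of _ n, symmetric]) simp_all
  finally have 0: "B\<^sub>0 *\<^sub>v bvp_orbit \<phi> \<psi> T a c 0 = B\<^sub>0 *\<^sub>v (Vs *\<^sub>v a + Vu *\<^sub>v (W ^\<^sub>m T *\<^sub>v c)) + B\<^sub>0 *\<^sub>v (Vu *\<^sub>v y)"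
    by (simp add: mult_add_distrib_mat_vec[OF B0])
  have "bvp_orbit \<phi> \<psi> T a c T = Vs *\<^sub>v (Ds ^\<^sub>m T *\<^sub>v a + x) + Vu *\<^sub>v c"
    unfolding bvp_orbit_def x_def using affine_orbit_split[OF Ds a \<phi>, where j = T] by simp
  also have "Vs *\<^sub>v (Ds ^\<^sub>m T *\<^sub>v a + x) = Vs *\<^sub>v (Ds ^\<^sub>m T *\<^sub>v a) + Vs *\<^sub>v x"
    by (intro mult_add_distrib_mat_vec[OF Vs]) simp_all
  also have "(Vs *\<^sub>v (Ds ^\<^sub>m T *\<^sub>v a) + Vs *\<^sub>v x) + Vu *\<^sub>v c = (Vs *\<^sub>v (Ds ^\<^sub>m T *\<^sub>v a) + Vu *\<^sub>v c) + Vs *\<^sub>v x"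
    using mult_carrier(2)[OF x] mult_carrier(3)[OF c] mult_carrier(2)[OF mult_carrier(9)[OF a, of T]] Vs Vu
    by (intro eq_vecI) auto
  finally have T: "B\<^sub>T *\<^sub>v bvp_orbit \<phi> \<psi> T a c T = B\<^sub>T *\<^sub>v (Vs *\<^sub>v (Ds ^\<^sub>m T *\<^sub>v a) + Vu *\<^sub>v c) + B\<^sub>T *\<^sub>v (Vs *\<^sub>v x)"
    by (simp add: mult_add_distrib_mat_vec[OF BT])
  show ?thesis
    unfolding 0 T \<Gamma>_mult_vec[OF a c] x_def[symmetric] y_def[symmetric]
    by (rule add_vec_swap[of _ n]) simp_all
qed

end

end

section \<open>The Green estimate\<close>

text \<open>The summand 1 ensures that the constant is at least 1. \<open>K * \<kappa> * S\<close>
  is the response to \<open>b\<close>, the doubled term the response to the boundary values of the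
  forced solution, and the last term the direct response to the forcing.\<close>

definition green_constant :: "real \<Rightarrow> real \<Rightarrow> real \<Rightarrow> real \<Rightarrow> real \<Rightarrow> real \<Rightarrow> real \<Rightarrow> real \<Rightarrow> real" where
  "green_constant K \<gamma> \<kappa> S \<beta>\<^sub>0 \<beta>\<^sub>T L\<^sub>s L\<^sub>u =
    1 + K * \<kappa> * S + 2 * (K * \<kappa> * S * (K * exp \<gamma> * (\<beta>\<^sub>0 * L\<^sub>u + \<beta>\<^sub>T * L\<^sub>s))) + K * exp \<gamma> * (L\<^sub>s + L\<^sub>u)"

context dichotomous_bvp
begin

abbreviation "C \<equiv> green_constant K \<gamma> \<kappa> S \<beta>\<^sub>0 \<beta>\<^sub>T L\<^sub>s L\<^sub>u"

lemma \<beta>_nonneg: "0 \<le> \<beta>\<^sub>0" "0 \<le> \<beta>\<^sub>T"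
  by (rule op_norm_nonneg[OF norms])+

lemma C_ge_1: "1 \<le> C"
  unfolding green_constant_def using K \<kappa> S_nonneg \<beta>_nonneg L_nonneg by simp

lemma bvp_unique:
  assumes T: "T0 \<le> T"
    and h: "bvp_solution n (\<lambda>h h'. h' - M *\<^sub>v h) B\<^sub>0 B\<^sub>T T f b h"
    and h': "bvp_solution n (\<lambda>h h'. h' - M *\<^sub>v h) B\<^sub>0 B\<^sub>T T f b h'"
  shows "h = h'"
proof (rule extensionalityI[of _ "{..T}"])
  show "h \<in> extensional {..T}" "h' \<in> extensional {..T}"
    using h h' by (auto simp: bvp_solution_def PiE_def)
  have c: "h t \<in> carrier_vec n" "h' t \<in> carrier_vec n" if "t \<le> T" for t
    using h h' that by (auto simp: bvp_solution_def)
  have Mc: "M *\<^sub>v h t \<in> carrier_vec n" "M *\<^sub>v h' t \<in> carrier_vec n" if "t \<le> T" for t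
    using c[OF that] by simp_all
  fix t assume t: "t \<in> {..T}"
  have "h t - h' t = 0\<^sub>v n"
  proof (rule homogeneous_bvp[OF T, of "\<lambda>t. h t - h' t"])
    show "h t - h' t \<in> carrier_vec n" if "t \<le> T" for t
      using c that by simp
    show "h (Suc t) - h' (Suc t) = M *\<^sub>v (h t - h' t)" if "t < T" for t
    proof -
      have "h (Suc t) - M *\<^sub>v h t = h' (Suc t) - M *\<^sub>v h' t"
        using h h' that by (simp add: bvp_solution_def)
      then have "h (Suc t) - h' (Suc t) = M *\<^sub>v h t - M *\<^sub>v h' t"
        by (rule minus_eq_minus_vec_swap) (use c[of "Suc t"] Mc[of t] that in auto)
      also have "\<dots> = M *\<^sub>v (h t - h' t)"
        using c[of t] that by (intro mult_minus_distrib_mat_vec[OF M, symmetric]) auto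
      finally show ?thesis .
    qed
    have "B\<^sub>0 *\<^sub>v (h 0 - h' 0) + B\<^sub>T *\<^sub>v (h T - h' T) =
        (B\<^sub>0 *\<^sub>v h 0 - B\<^sub>0 *\<^sub>v h' 0) + (B\<^sub>T *\<^sub>v h T - B\<^sub>T *\<^sub>v h' T)"
      by (simp only: mult_minus_distrib_mat_vec[OF B0 c[OF le0]] mult_minus_distrib_mat_vec[OF BT c[OF order_refl]])
    also have "\<dots> = (B\<^sub>0 *\<^sub>v h 0 + B\<^sub>T *\<^sub>v h T) - (B\<^sub>0 *\<^sub>v h' 0 + B\<^sub>T *\<^sub>v h' T)"
      using mult_carrier(7)[OF c(1)[of 0]] mult_carrier(7)[OF c(2)[of 0]] 
        mult_carrier(8)[OF c(1)[of T]] mult_carrier(8)[OF c(2)[of T]] B0 BT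
      by (intro eq_vecI) auto
    also have "B\<^sub>0 *\<^sub>v h 0 + B\<^sub>T *\<^sub>v h T = B\<^sub>0 *\<^sub>v h' 0 + B\<^sub>T *\<^sub>v h' T"
      using h h' by (simp add: bvp_solution_def)
    also have "(B\<^sub>0 *\<^sub>v h' 0 + B\<^sub>T *\<^sub>v h' T) - (B\<^sub>0 *\<^sub>v h' 0 + B\<^sub>T *\<^sub>v h' T) = 0\<^sub>v n"
      using mult_carrier(7)[OF c(2)[of 0]] mult_carrier(8)[OF c(2)[of T]] by simp
    finally show "B\<^sub>0 *\<^sub>v (h 0 - h' 0) + B\<^sub>T *\<^sub>v (h T - h' T) = 0\<^sub>v n" .
  qed (use t in simp)
  then show "h t = h' t"
    by (rule minus_eq_0_vecD) (use c[of t] t in auto)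
qed

lemma bvp_exists_bound:
  assumes T: "T0 \<le> T" and f: "f \<in> {..<T} \<rightarrow>\<^sub>E carrier_vec n" and b: "b \<in> carrier_vec n"
  shows "\<exists>h. bvp_solution n (\<lambda>h h'. h' - M *\<^sub>v h) B\<^sub>0 B\<^sub>T T f b h \<and>
    (\<forall>t\<le>T. \<nu> n (h t) \<le> C * ((exp (- \<gamma> * real t) + exp (- \<gamma> * (real T - real t))) * \<nu> n b +
      (\<Sum>s<T. green_kernel \<gamma> T t s * \<nu> n (f s))))"
proof -
  have fc: "f t \<in> carrier_vec n" if "t < T" for t
    using f that by auto
  \<comment> \<open>The coordinates are set to zero from \<open>T\<close> on, so that they form
    total sequences, as the orbit lemmas require.\<close>
  have "\<exists>p. fst p \<in> carrier_vec r \<and> snd p \<in> carrier_vec s \<and> (t < T \<longrightarrow> f t = Vs *\<^sub>v fst p + Vu *\<^sub>v snd p)" for t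
  proof (cases "t < T")
    case True
    from split_surj[OF fc[OF this]] obtain a c where "a \<in> carrier_vec r" "c \<in> carrier_vec s" "f t = Vs *\<^sub>v a + Vu *\<^sub>v c"
      by blast
    then show ?thesis by (intro exI[of _ "(a, c)"]) simp
  next
    case False
    then show ?thesis by (intro exI[of _ "(0\<^sub>v r, 0\<^sub>v s)"]) simp
  qed
  then have "\<forall>t. \<exists>p. fst p \<in> carrier_vec r \<and> snd p \<in> carrier_vec s \<and> (t < T \<longrightarrow> f t = Vs *\<^sub>v fst p + Vu *\<^sub>v snd p)"
    by blast
  from choice[OF this] obtain p where p: "\<And>t. fst (p t) \<in> carrier_vec r" "\<And>t. snd (p t) \<in> carrier_vec s"
    "\<And>t. t < T \<Longrightarrow> f t = Vs *\<^sub>v fst (p t) + Vu *\<^sub>v snd (p t)"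
    by blast
  define \<phi> where "\<phi> t = fst (p t)" for t
  define \<psi> where "\<psi> t = snd (p t)" for t
  have \<phi>: "\<phi> t \<in> carrier_vec r" and \<psi>: "\<psi> t \<in> carrier_vec s" for t
    using p(1,2) by (simp_all add: \<phi>_def \<psi>_def)
  have f_eq: "f t = Vs *\<^sub>v \<phi> t + Vu *\<^sub>v \<psi> t" if "t < T" for t
    using p(3)[OF that] by (simp add: \<phi>_def \<psi>_def)
  define F where "F t = (if t < T then \<nu> n (f t) else 0)" for t
  have F0: "0 \<le> F t" for t
    using vnorm_nonneg[OF norms fc] by (simp add: F_def)
  have F\<phi>: "\<nu> r (\<phi> t) \<le> L\<^sub>s * F t" and F\<psi>: "\<nu> s (\<psi> t) \<le> L\<^sub>u * F t" if "t < T" for t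
    using stable_coord_le[OF \<phi> \<psi>, of t t] unstable_coord_le[OF \<phi> \<psi>, of t t] that f_eq[OF that]
    by (simp_all add: F_def)
  define X where "X t = (\<Sum>j<T. exp (- \<gamma> * \<bar>real t - real j\<bar>) * F j)" for t
  define us where "us = Vu *\<^sub>v affine_orbit W (unstable_forcing \<psi> T) (0\<^sub>v s) T"
  define ss where "ss = Vs *\<^sub>v affine_orbit Ds \<phi> (0\<^sub>v r) T"
  define \<rho> where "\<rho> = B\<^sub>0 *\<^sub>v us + B\<^sub>T *\<^sub>v ss"
  have us: "us \<in> carrier_vec n" and ss: "ss \<in> carrier_vec n"
    using stable_orbit_carrier[OF \<phi> zero_carrier_vec] unstable_orbit_carrier[OF \<psi> zero_carrier_vec]
    by (simp_all add: us_def ss_def)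
  have \<rho>: "\<rho> \<in> carrier_vec n" using us ss by (simp add: \<rho>_def)
  have us_le: "\<nu> n us \<le> K * exp \<gamma> * L\<^sub>u * X 0"
    using unstable_orbit_bound[where \<psi> = \<psi> and T = T and F = F and t = 0, OF \<psi> zero_carrier_vec F\<psi> F0] vnorm_zero[OF norms]
    by (simp add: us_def X_def)
  have ss_le: "\<nu> n ss \<le> K * exp \<gamma> * L\<^sub>s * X T"
    using stable_orbit_bound[where \<phi> = \<phi> and T = T and F = F and t = T, OF \<phi> zero_carrier_vec F\<phi> F0] vnorm_zero[OF norms]
    by (simp add: ss_def X_def)
  note inv = invertible_matE[OF \<Gamma>_inv[OF T] \<Gamma>_carrier[of T]]
  define x where "x = mat_inv (\<Gamma> T) *\<^sub>v (b - \<rho>)"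
  have b\<rho>: "b - \<rho> \<in> carrier_vec n" using b \<rho> by simp
  have x: "x \<in> carrier_vec n"
    unfolding x_def by (rule mult_mat_vec_carrier[OF inv(2) b\<rho>])
  have \<Gamma>x: "\<Gamma> T *\<^sub>v x = b - \<rho>"
    using assoc_mult_mat_vec[OF \<Gamma>_carrier[of T] inv(2) b\<rho>] unfolding x_def inv(3) one_mult_mat_vec[OF b\<rho>] by simp
  define a where "a = vec_first x r"
  define c where "c = vec_last x s"
  have a: "a \<in> carrier_vec r" and c: "c \<in> carrier_vec s" by (simp_all add: a_def c_def)
  have ac: "a @\<^sub>v c = x" using x rs by (simp add: a_def c_def)
  define h where "h = restrict (bvp_orbit \<phi> \<psi> T a c) {..T}"
  have "bvp_solution n (\<lambda>h h'. h' - M *\<^sub>v h) B\<^sub>0 B\<^sub>T T f b h"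
    unfolding bvp_solution_def
  proof (intro conjI allI impI)
    show "h \<in> {..T} \<rightarrow>\<^sub>E carrier_vec n"
      using bvp_orbit_carrier[OF \<phi> \<psi> a c] by (auto simp: h_def)
    show "h (Suc t) - M *\<^sub>v h t = f t" if "t < T" for t
      using bvp_orbit_step[OF \<phi> \<psi> a c that] f_eq[OF that] that by (simp add: h_def)
    have "B\<^sub>0 *\<^sub>v h 0 + B\<^sub>T *\<^sub>v h T = b - \<rho> + \<rho>"
      using bvp_orbit_boundary[OF \<phi> \<psi> a c, where T = T] unfolding ac \<Gamma>x by (simp add: h_def \<rho>_def us_def ss_def)
    also have "\<dots> = b"
      using b \<rho> by (intro eq_vecI) auto
    finally show "B\<^sub>0 *\<^sub>v h 0 + B\<^sub>T *\<^sub>v h T = b" .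
  qed
  moreover have "\<nu> n (h t) \<le> C * ((exp (- \<gamma> * real t) + exp (- \<gamma> * (real T - real t))) * \<nu> n b +
      (\<Sum>s<T. green_kernel \<gamma> T t s * \<nu> n (f s)))" if t: "t \<le> T" for t
  proof -
    define w where "w j = exp (- \<gamma> * real j) + exp (- \<gamma> * (real T - real j))" for j
    define Y where "Y = (\<Sum>j<T. w j * F j)"
    define G where "G = (\<Sum>j<T. green_kernel \<gamma> T t j * F j)"
    define \<eta> where "\<eta> = K * exp \<gamma> * (\<beta>\<^sub>0 * L\<^sub>u + \<beta>\<^sub>T * L\<^sub>s)"
    have w0: "0 \<le> w j" for j by (simp add: w_def)
    have \<eta>0: "0 \<le> \<eta>" using K \<beta>_nonneg L_nonneg by (simp add: \<eta>_def)
    \<comment> \<open>At either end, \<open>exp (- \<gamma> * \<bar>real t - real j\<bar>)\<close>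
      is one of the two summands of \<open>w j\<close>, so both contributions to
      \<open>\<rho>\<close> are measured by the single quantity \<open>Y\<close>.\<close>
    have X_le_Y: "X 0 \<le> Y" "X T \<le> Y"
      unfolding X_def Y_def w_def using F0 by (auto intro!: sum_mono mult_right_mono)
    have X_le_G: "X t \<le> G"
      unfolding X_def G_def by (intro sum_mono mult_right_mono exp_abs_le_green_kernel F0)
    \<comment> \<open>The end values \<open>a\<close> and \<open>c\<close> depend on the forcing
      through \<open>Y\<close> and act at time \<open>t\<close> with total weight
      \<open>w t\<close>; this product accounts for the boundary terms of the kernel.\<close>
    have wY: "w t * Y \<le> 2 * G"
    proof -
      have "w t * Y = (\<Sum>j<T. (w t * w j) * F j)"
        by (simp add: Y_def sum_distrib_left mult.assoc)
      also have "\<dots> \<le> (\<Sum>j<T. (2 * green_kernel \<gamma> T t j) * F j)"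
        unfolding w_def using boundary_weight_mult_le_green_kernel[OF \<gamma> t] F0
        by (intro sum_mono mult_right_mono) auto
      also have "\<dots> = 2 * G"
        by (simp add: G_def sum_distrib_left mult.assoc)
      finally show ?thesis .
    qed
    have "\<nu> n \<rho> \<le> \<beta>\<^sub>0 * \<nu> n us + \<beta>\<^sub>T * \<nu> n ss"
      unfolding \<rho>_def
      using vnorm_add[OF norms mult_carrier(7)[OF us] mult_carrier(8)[OF ss]]
        vnorm_mult_mat_vec_le[OF norms B0 us] vnorm_mult_mat_vec_le[OF norms BT ss] by linarith
    also have "\<dots> \<le> \<beta>\<^sub>0 * (K * exp \<gamma> * L\<^sub>u * Y) + \<beta>\<^sub>T * (K * exp \<gamma> * L\<^sub>s * Y)"
    proof (intro add_mono mult_left_mono \<beta>_nonneg)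
      show "\<nu> n us \<le> K * exp \<gamma> * L\<^sub>u * Y"
        using us_le mult_left_mono[OF X_le_Y(1), of "K * exp \<gamma> * L\<^sub>u"] K L_nonneg by simp
      show "\<nu> n ss \<le> K * exp \<gamma> * L\<^sub>s * Y"
        using ss_le mult_left_mono[OF X_le_Y(2), of "K * exp \<gamma> * L\<^sub>s"] K L_nonneg by simp
    qed
    finally have \<rho>_le: "\<nu> n \<rho> \<le> \<eta> * Y" by (simp add: \<eta>_def algebra_simps)
    have "\<nu> n x \<le> S * (\<nu> n b + \<nu> n \<rho>)"
      using vnorm_le_\<Gamma>[OF T x] mult_left_mono[OF vnorm_diff[OF norms b \<rho>] S_nonneg] unfolding \<Gamma>x by simp
    also have "\<dots> \<le> S * (\<nu> n b + \<eta> * Y)"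
      using \<rho>_le S_nonneg by (intro mult_left_mono) auto
    finally have "\<kappa> * \<nu> n x \<le> \<kappa> * (S * (\<nu> n b + \<eta> * Y))"
      using \<kappa> by (rule mult_left_mono)
    then have a_le: "\<nu> r a \<le> \<kappa> * (S * (\<nu> n b + \<eta> * Y))" and c_le: "\<nu> s c \<le> \<kappa> * (S * (\<nu> n b + \<eta> * Y))"
      using split_le[OF a c] unfolding ac by linarith+
    have st: "Vs *\<^sub>v affine_orbit Ds \<phi> a t \<in> carrier_vec n" and un: "Vu *\<^sub>v affine_orbit W (unstable_forcing \<psi> T) c (T - t) \<in> carrier_vec n"
      using stable_orbit_carrier[OF \<phi> a] unstable_orbit_carrier[OF \<psi> c] by simp_all
    have "\<nu> n (h t) = \<nu> n (Vs *\<^sub>v affine_orbit Ds \<phi> a t + Vu *\<^sub>v affine_orbit W (unstable_forcing \<psi> T) c (T - t))"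
      using t by (simp add: h_def bvp_orbit_def)
    also have "\<dots> \<le> (K * exp (- \<gamma> * real t) * \<nu> r a + K * exp \<gamma> * L\<^sub>s * X t) +
        (K * exp (- \<gamma> * (real T - real t)) * \<nu> s c + K * exp \<gamma> * L\<^sub>u * X t)"
      unfolding X_def
      using stable_orbit_bound[where \<phi> = \<phi> and T = T and F = F, OF \<phi> a F\<phi> F0 t]
        unstable_orbit_bound[where \<psi> = \<psi> and T = T and F = F, OF \<psi> c F\<psi> F0 t]
      by (intro order_trans[OF vnorm_add[OF norms st un]] add_mono)
    also have "\<dots> \<le> (K * exp (- \<gamma> * real t) * (\<kappa> * (S * (\<nu> n b + \<eta> * Y))) + K * exp \<gamma> * L\<^sub>s * G) +
        (K * exp (- \<gamma> * (real T - real t)) * (\<kappa> * (S * (\<nu> n b + \<eta> * Y))) + K * exp \<gamma> * L\<^sub>u * G)"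
      using a_le c_le X_le_G K L_nonneg by (intro add_mono mult_left_mono) auto
    also have "\<dots> = K * \<kappa> * S * (w t * \<nu> n b) + K * \<kappa> * S * \<eta> * (w t * Y) + K * exp \<gamma> * (L\<^sub>s + L\<^sub>u) * G"
      by (simp add: w_def algebra_simps)
    also have "\<dots> \<le> K * \<kappa> * S * (w t * \<nu> n b) + K * \<kappa> * S * \<eta> * (2 * G) + K * exp \<gamma> * (L\<^sub>s + L\<^sub>u) * G"
      using K \<kappa> S_nonneg \<eta>0 by (intro add_right_mono add_left_mono mult_left_mono[OF wY]) simp
    also have "\<dots> \<le> C * (w t * \<nu> n b) + C * G"
    proof -
      have G0: "0 \<le> G"
        unfolding G_def by (intro sum_nonneg mult_nonneg_nonneg green_kernel_nonneg F0)
      have nonneg: "0 \<le> K * \<kappa> * S" "0 \<le> K * \<kappa> * S * \<eta>" "0 \<le> K * exp \<gamma> * (L\<^sub>s + L\<^sub>u)"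
        using K \<kappa> S_nonneg \<eta>0 L_nonneg by simp_all
      have C_eq: "C = 1 + K * \<kappa> * S + 2 * (K * \<kappa> * S * \<eta>) + K * exp \<gamma> * (L\<^sub>s + L\<^sub>u)"
        by (simp add: green_constant_def \<eta>_def)
      have "K * \<kappa> * S * (w t * \<nu> n b) \<le> C * (w t * \<nu> n b)"
        using nonneg w0 vnorm_nonneg[OF norms b] unfolding C_eq by (intro mult_right_mono) auto
      moreover have "(2 * (K * \<kappa> * S * \<eta>) + K * exp \<gamma> * (L\<^sub>s + L\<^sub>u)) * G \<le> C * G"
        using nonneg G0 unfolding C_eq by (intro mult_right_mono) auto
      ultimately show ?thesis by (simp add: algebra_simps)
    qed
    also have "G = (\<Sum>s<T. green_kernel \<gamma> T t s * \<nu> n (f s))"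
      by (simp add: G_def F_def)
    finally show ?thesis
      by (simp add: w_def distrib_left)
  qed
  ultimately show ?thesis by blast
qed

lemma uniform_green_bvp:
  assumes T0: "1 \<le> T0"
  shows "uniform_green \<nu> n (\<lambda>h h'. h' - M *\<^sub>v h) B\<^sub>0 B\<^sub>T C \<gamma> T0"
  unfolding uniform_green_def
proof (intro conjI allI impI ballI)
  fix T and f :: "nat \<Rightarrow> real vec" and b :: "real vec"
  assume T: "T0 \<le> T" and f: "f \<in> {..<T} \<rightarrow>\<^sub>E carrier_vec n" and b: "b \<in> carrier_vec n"
  obtain h where h: "bvp_solution n (\<lambda>h h'. h' - M *\<^sub>v h) B\<^sub>0 B\<^sub>T T f b h"
    "\<forall>t\<le>T. \<nu> n (h t) \<le> C * ((exp (- \<gamma> * real t) + exp (- \<gamma> * (real T - real t))) * \<nu> n b +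
      (\<Sum>s<T. green_kernel \<gamma> T t s * \<nu> n (f s)))"
    using bvp_exists_bound[OF T f b] by blast
  show "\<exists>!h. bvp_solution n (\<lambda>h h'. h' - M *\<^sub>v h) B\<^sub>0 B\<^sub>T T f b h"
    using h(1) bvp_unique[OF T] by blast
  fix h' t assume "bvp_solution n (\<lambda>h h'. h' - M *\<^sub>v h) B\<^sub>0 B\<^sub>T T f b h'" and t: "t \<le> T"
  then have "h' = h" using h(1) bvp_unique[OF T] by blast
  with h(2) t show "\<nu> n (h' t) \<le> C * ((exp (- \<gamma> * real t) + exp (- \<gamma> * (real T - real t))) * \<nu> n b +
      (\<Sum>s<T. green_kernel \<gamma> T t s * \<nu> n (f s)))" by blast
qed (use C_ge_1 \<gamma> T0 B0 BT linear_pair_map_diff_mult[OF M] in auto)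

end

section \<open>From the spectral hypotheses to the abstract setting\<close>

text \<open>The substantial conclusion is the last: if \<open>Du\<close> kills \<open>c\<close>,
  then \<open>M\<close> kills \<open>Vu *\<^sub>v c\<close>, which lies in a spectral subspace away
  from the eigenvalue 0 and is therefore zero.\<close>

lemma dichotomyD:
  assumes "dichotomy \<nu> n M Vs Vu Ds Du K \<gamma>"
  shows "M \<in> carrier_mat n n" "Vs \<in> carrier_mat n (dim_col Vs)" "Vu \<in> carrier_mat n (dim_col Vu)"
    and "Ds \<in> carrier_mat (dim_col Vs) (dim_col Vs)" "Du \<in> carrier_mat (dim_col Vu) (dim_col Vu)"
    and "M * Vs = Vs * Ds" "M * Vu = Vu * Du" "0 \<le> K" "0 < \<gamma>"
    and "\<And>k. op_norm \<nu> (Vs * (Ds ^\<^sub>m k)) \<le> K * exp (- \<gamma> * real k)"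
    and "\<And>k. op_norm \<nu> (Vu * (mat_inv Du ^\<^sub>m k)) \<le> K * exp (- \<gamma> * real k)"
    and "stable_subspace n M = {Vs *\<^sub>v a | a. a \<in> carrier_vec (dim_col Vs)}"
    and "unstable_subspace n M = {Vu *\<^sub>v c | c. c \<in> carrier_vec (dim_col Vu)}"
    and "invertible_mat Du"
proof -
  have M: "M \<in> carrier_mat n n"
    and basis: "columns_basis n (stable_subspace n M) Vs" "columns_basis n (unstable_subspace n M) Vu"
    and Du: "Du \<in> carrier_mat (dim_col Vu) (dim_col Vu)" and MVu: "M * Vu = Vu * Du"
    using assms by (auto simp: dichotomy_def)
  show "M \<in> carrier_mat n n" "Du \<in> carrier_mat (dim_col Vu) (dim_col Vu)" "M * Vu = Vu * Du"
    by (fact M Du MVu)+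
  show "Ds \<in> carrier_mat (dim_col Vs) (dim_col Vs)" "M * Vs = Vs * Ds" "0 \<le> K" "0 < \<gamma>"
    "\<And>k. op_norm \<nu> (Vs * (Ds ^\<^sub>m k)) \<le> K * exp (- \<gamma> * real k)"
    "\<And>k. op_norm \<nu> (Vu * (mat_inv Du ^\<^sub>m k)) \<le> K * exp (- \<gamma> * real k)"
    using assms by (auto simp: dichotomy_def)
  show "Vs \<in> carrier_mat n (dim_col Vs)" and Vu: "Vu \<in> carrier_mat n (dim_col Vu)"
    using basis unfolding columns_basis_def by (blast intro: carrier_matI)+
  have sub: "subspace class_ring (stable_subspace n M) (module_vec TYPE(real) n)"
    "subspace class_ring (unstable_subspace n M) (module_vec TYPE(real) n)"
    unfolding stable_subspace_def unstable_subspace_def by (rule subspace_spectral_subspace[OF M])+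
  show "stable_subspace n M = {Vs *\<^sub>v a | a. a \<in> carrier_vec (dim_col Vs)}"
    by (rule columns_basis_span[OF sub(1) basis(1)])
  show E: "unstable_subspace n M = {Vu *\<^sub>v c | c. c \<in> carrier_vec (dim_col Vu)}"
    by (rule columns_basis_span[OF sub(2) basis(2)])
  show "invertible_mat Du"
  proof (rule invertible_matI_inj[OF Du])
    fix c assume c: "c \<in> carrier_vec (dim_col Vu)" and "Du *\<^sub>v c = 0\<^sub>v (dim_col Vu)"
    then have "M *\<^sub>v (Vu *\<^sub>v c) = 0\<^sub>v n"
      using assoc_mult_mat_vec[OF M Vu c] assoc_mult_mat_vec[OF Vu Du c] MVu mult_mat_zero_vec[OF Vu] by simp
    moreover have "Vu *\<^sub>v c \<in> spectral_subspace n M {z. cmod z > 1}"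
      using E c unfolding unstable_subspace_def by auto
    moreover have "0 \<notin> {z. cmod z > 1}" by simp
    ultimately have "Vu *\<^sub>v c = 0\<^sub>v n"
      using spectral_subspace_kernel[OF M] by metis
    then show "c = 0\<^sub>v (dim_col Vu)"
      by (rule columns_basis_inj[OF sub(2) basis(2) c])
  qed
qed

text \<open>The column count is kept as a sum, to be identified with \<open>n\<close> through
  invertibility.\<close>

lemma Gamma_hat_carrier:
  assumes "dichotomy \<nu> n M Vs Vu Ds Du K \<gamma>" "B\<^sub>0 \<in> carrier_mat n n" "B\<^sub>T \<in> carrier_mat n n"
  shows "Gamma_hat B\<^sub>0 B\<^sub>T Vs Vu Ds Du N \<in> carrier_mat n (dim_col Vs + dim_col Vu)"
proof -
  note D = dichotomyD[OF assms(1)]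
  note W = invertible_matE(2)[OF D(14) D(5)]
  show ?thesis
    unfolding Gamma_hat_def
    by (intro append_columns_carrier add_carrier_mat mult_carrier_mat[OF mult_carrier_mat[OF assms(2) D(3)]]
        mult_carrier_mat[OF assms(3) D(3)] pow_carrier_mat[OF W]
        mult_carrier_mat[OF mult_carrier_mat[OF assms(3) D(2)]] pow_carrier_mat[OF D(4)])
qed

text \<open>The supremum is at least a real number and below infinity, so
  \<open>real_of_ereal\<close> does not fall back to its value 0 at infinity.\<close>

lemma op_norm_le_sup_inv_norm:
  assumes norms: "\<And>k. is_vec_norm k (\<nu> k)" and fin: "sup_inv_norm \<nu> \<Gamma> T0 < \<infinity>" and N: "T0 \<le> N"
  shows "op_norm \<nu> (mat_inv (\<Gamma> N)) \<le> real_of_ereal (sup_inv_norm \<nu> \<Gamma> T0)"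
proof -
  have le: "ereal (op_norm \<nu> (mat_inv (\<Gamma> N))) \<le> sup_inv_norm \<nu> \<Gamma> T0"
    unfolding sup_inv_norm_def using N by (intro SUP_upper) simp
  with fin show ?thesis
    by (cases "sup_inv_norm \<nu> \<Gamma> T0") auto
qed

theorem theorem3p2:
  fixes \<nu> :: "nat \<Rightarrow> real vec \<Rightarrow> real"
  assumes norms: "\<And>k. is_vec_norm k (\<nu> k)"
  shows
    "(\<exists>C :: real \<Rightarrow> real \<Rightarrow> real \<Rightarrow> real \<Rightarrow> real mat \<Rightarrow> real mat \<Rightarrow> real \<Rightarrow> real.
        \<forall>n M Vs Vu Ds Du K \<gamma> B\<^sub>0 B\<^sub>T. \<forall>T0::nat.
          dichotomy \<nu> n M Vs Vu Ds Du K \<gamma> \<longrightarrow>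
          B\<^sub>0 \<in> carrier_mat n n \<longrightarrow> B\<^sub>T \<in> carrier_mat n n \<longrightarrow> T0 \<ge> 1 \<longrightarrow>
          (\<forall>N\<ge>T0. invertible_mat (Gamma_hat B\<^sub>0 B\<^sub>T Vs Vu Ds Du N)) \<longrightarrow>
          sup_inv_norm \<nu> (Gamma_hat B\<^sub>0 B\<^sub>T Vs Vu Ds Du) T0 < \<infinity> \<longrightarrow>
          uniform_green \<nu> n (\<lambda>h h'. h' - M *\<^sub>v h) B\<^sub>0 B\<^sub>T
            (C K \<gamma> (op_norm \<nu> (stable_projector n M)) (op_norm \<nu> (unstable_projector n M))
               B\<^sub>0 B\<^sub>T (real_of_ereal (sup_inv_norm \<nu> (Gamma_hat B\<^sub>0 B\<^sub>T Vs Vu Ds Du) T0)))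
            \<gamma> T0)
     \<and>
     (\<forall>n M Vs Vu Ds Du K \<gamma> B\<^sub>0 B\<^sub>T. \<forall>T0::nat.
        dichotomy \<nu> n M Vs Vu Ds Du K \<gamma> \<longrightarrow>
        B\<^sub>0 \<in> carrier_mat n n \<longrightarrow> B\<^sub>T \<in> carrier_mat n n \<longrightarrow> T0 \<ge> 1 \<longrightarrow>
        invertible_mat (Gamma_inf B\<^sub>0 B\<^sub>T Vs Vu) \<longrightarrow>
        (\<exists>Nc::nat.
           (SUP N \<in> {Nc..}. ereal (op_norm \<nu> (mat_inv (Gamma_inf B\<^sub>0 B\<^sub>T Vs Vu)) *
              op_norm \<nu> (Gamma_hat B\<^sub>0 B\<^sub>T Vs Vu Ds Du N - Gamma_inf B\<^sub>0 B\<^sub>T Vs Vu))) < 1 \<and>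
           (\<forall>N. T0 \<le> N \<and> N < Nc \<longrightarrow> invertible_mat (Gamma_hat B\<^sub>0 B\<^sub>T Vs Vu Ds Du N))) \<longrightarrow>
        (\<forall>N\<ge>T0. invertible_mat (Gamma_hat B\<^sub>0 B\<^sub>T Vs Vu Ds Du N)) \<and>
        sup_inv_norm \<nu> (Gamma_hat B\<^sub>0 B\<^sub>T Vs Vu Ds Du) T0 < \<infinity>)"
proof (rule conjI, goal_cases)
  case 1
  have "\<forall>n. \<exists>k\<ge>0. \<forall>r s. r + s = n \<longrightarrow> (\<forall>a \<in> carrier_vec r. \<forall>c \<in> carrier_vec s.
      \<nu> r a \<le> k * \<nu> n (a @\<^sub>v c) \<and> \<nu> s c \<le> k * \<nu> n (a @\<^sub>v c))"
    by (intro allI vnorm_split_le norms)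
  from choice[OF this] obtain \<kappa> :: "nat \<Rightarrow> real"
    where "\<forall>n. 0 \<le> \<kappa> n \<and> (\<forall>r s. r + s = n \<longrightarrow> (\<forall>a \<in> carrier_vec r. \<forall>c \<in> carrier_vec s.
      \<nu> r a \<le> \<kappa> n * \<nu> n (a @\<^sub>v c) \<and> \<nu> s c \<le> \<kappa> n * \<nu> n (a @\<^sub>v c)))"
    by (elim exE)
  then have \<kappa>: "0 \<le> \<kappa> n"
    "r + s = n \<Longrightarrow> a \<in> carrier_vec r \<Longrightarrow> c \<in> carrier_vec s \<Longrightarrow>
      \<nu> r a \<le> \<kappa> n * \<nu> n (a @\<^sub>v c) \<and> \<nu> s c \<le> \<kappa> n * \<nu> n (a @\<^sub>v c)" for n r s a c
    by blast+
  \<comment> \<open>\<open>C\<close> has no argument for the dimension, which is recovered as the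
    number of rows of the first boundary matrix. The splitting factors have been chosen for all
    dimensions beforehand, hence depend only on the fixed norms.\<close>
  define C where "C K \<gamma> p q B\<^sub>0 B\<^sub>T S = (let k = \<kappa> (dim_row B\<^sub>0) in
    green_constant K \<gamma> k S (op_norm \<nu> B\<^sub>0) (op_norm \<nu> B\<^sub>T) (k * S * op_norm \<nu> B\<^sub>0 * p) (k * S * op_norm \<nu> B\<^sub>T * q))"
    for K \<gamma> p q :: real and B\<^sub>0 B\<^sub>T :: "real mat" and S :: real
  show ?case
  proof (rule exI[of _ C], intro allI impI)
    fix n M Vs Vu Ds Du K \<gamma> B\<^sub>0 B\<^sub>T and T0 :: nat
    let ?\<Gamma> = "Gamma_hat B\<^sub>0 B\<^sub>T Vs Vu Ds Du"
    let ?S = "real_of_ereal (sup_inv_norm \<nu> ?\<Gamma> T0)"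
    assume D: "dichotomy \<nu> n M Vs Vu Ds Du K \<gamma>" and B0: "B\<^sub>0 \<in> carrier_mat n n" and BT: "B\<^sub>T \<in> carrier_mat n n"
      and T0: "1 \<le> T0" and inv: "\<forall>N\<ge>T0. invertible_mat (?\<Gamma> N)" and fin: "sup_inv_norm \<nu> ?\<Gamma> T0 < \<infinity>"
    note d = dichotomyD[OF D]
    \<comment> \<open>The boundary matrix at the horizon \<open>T0\<close> is invertible, hence
      square.\<close>
    have rs: "dim_col Vs + dim_col Vu = n"
      using inv by (intro invertible_matE(1)[OF _ Gamma_hat_carrier[OF D B0 BT, of T0]]) simp
    have "\<nu> (dim_col Vs) a \<le> \<kappa> n * \<nu> n (a @\<^sub>v c)" "\<nu> (dim_col Vu) c \<le> \<kappa> n * \<nu> n (a @\<^sub>v c)"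
      if "a \<in> carrier_vec (dim_col Vs)" "c \<in> carrier_vec (dim_col Vu)" for a c
      using \<kappa>(2)[OF rs that] by simp_all
    moreover have "invertible_mat (?\<Gamma> N)" if "T0 \<le> N" for N
      using inv that by simp
    ultimately interpret dichotomous_bvp \<nu> n "dim_col Vs" "dim_col Vu" M Vs Vu Ds Du B\<^sub>0 B\<^sub>T K \<gamma> "\<kappa> n" ?S T0
      by (intro dichotomous_bvp.intro norms d(1-11,14) B0 BT rs \<kappa>(1) op_norm_le_sup_inv_norm[OF norms fin])
    show "uniform_green \<nu> n (\<lambda>h h'. h' - M *\<^sub>v h) B\<^sub>0 B\<^sub>T
      (C K \<gamma> (op_norm \<nu> (stable_projector n M)) (op_norm \<nu> (unstable_projector n M)) B\<^sub>0 B\<^sub>T ?S) \<gamma> T0"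
      using uniform_green_bvp[OF T0] carrier_matD(1)[OF B0]
      by (simp add: C_def Let_def L\<^sub>s_def L\<^sub>u_def stable_projector_def unstable_projector_def d(12,13))
  qed
next
  case 2
  show ?case
  proof (intro allI impI, elim exE conjE)
    fix n M Vs Vu Ds Du K \<gamma> B\<^sub>0 B\<^sub>T and T0 Nc :: nat
    assume D: "dichotomy \<nu> n M Vs Vu Ds Du K \<gamma>" and B0: "B\<^sub>0 \<in> carrier_mat n n" and BT: "B\<^sub>T \<in> carrier_mat n n"
      and inv: "invertible_mat (Gamma_inf B\<^sub>0 B\<^sub>T Vs Vu)"
      and less: "(SUP N \<in> {Nc..}. ereal (op_norm \<nu> (mat_inv (Gamma_inf B\<^sub>0 B\<^sub>T Vs Vu)) *
        op_norm \<nu> (Gamma_hat B\<^sub>0 B\<^sub>T Vs Vu Ds Du N - Gamma_inf B\<^sub>0 B\<^sub>T Vs Vu))) < 1"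
      and init: "\<forall>N. T0 \<le> N \<and> N < Nc \<longrightarrow> invertible_mat (Gamma_hat B\<^sub>0 B\<^sub>T Vs Vu Ds Du N)"
    note d = dichotomyD[OF D]
    have G: "Gamma_inf B\<^sub>0 B\<^sub>T Vs Vu \<in> carrier_mat n (dim_col Vs + dim_col Vu)"
      unfolding Gamma_inf_def
      by (intro append_columns_carrier mult_carrier_mat[OF B0 d(2)] mult_carrier_mat[OF BT d(3)])
    \<comment> \<open>Here squareness comes from the invertible limit matrix.\<close>
    have rs: "dim_col Vs + dim_col Vu = n"
      by (rule invertible_matE(1)[OF inv G])
    show "(\<forall>N\<ge>T0. invertible_mat (Gamma_hat B\<^sub>0 B\<^sub>T Vs Vu Ds Du N)) \<and>
        sup_inv_norm \<nu> (Gamma_hat B\<^sub>0 B\<^sub>T Vs Vu Ds Du) T0 < \<infinity>"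
      using G Gamma_hat_carrier[OF D B0 BT] init unfolding rs
      by (intro sup_inv_norm_less_infty[OF norms _ inv _ less]) auto
  qed
qed

end
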